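(* Let $d\ge 2$. Let $P=(p^{(1)},\ldots,p^{(d)})$ and $Q=(q^{(1)},\ldots,q^{(d)})$ be tuples of (finite) probability vectors (the entries of $P$ all of the same length, and likewise for $Q$) such that $\bigcap_{k=1}^d\operatorname{supp}p^{(k)}\neq\emptyset$ and $\bigcap_{k=1}^d\operatorname{supp}q^{(k)}\neq\emptyset$. Suppose that $$\Phi_{\underline\alpha,C}(P)<\Phi_{\underline\alpha,C}(Q)\qquad\text{for all }(\underline\alpha,C)\in\mathcal I_d. \qquad( * )$$ Then the following hold. (a) There exist a stochastic map $T$ and a tuple of probability vectors $(r^{(1)},\ldots,r^{(d)})$ satisfying $\bigcap_{k=1}^d\operatorname{supp}r^{(k)}\neq\emptyset$ such that $$T(r^{(k)}\otimes p^{(k)})=r^{(k)}\otimes q^{(k)}\quad\text{for all }k\in[d],$$ and one may choose, for $n$ sufficiently large, $$r^{(k)}=\frac1{n+1}\bigoplus_{\ell=0}^n (q^{(k)})^{\otimes\ell}\otimes(p^{(k)})^{\otimes(n-\ell)}\quad\text{for }k\in[d].$$ (b) For all $n$ sufficiently large there exists a stochastic map $T_n$ such that $$T_n (p^{(k)})^{\otimes n}=(q^{(k)})^{\otimes n}\quad\text{for all }k\in[d].$$ Conversely, if either (a) or (b) holds, then the inequalities in $( * )$ hold non-strictly, i.e. $\Phi_{\underline\alpha,C}(P)\le\Phi_{\underline\alpha,C}(Q)$ for all $(\underline\alpha,C)\in\mathcal I_d$.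
   Context: Notation: $[d]=\{1,\ldots,d\}$; $\mathbb R_+=[0,\infty)$; $\operatorname{supp}x$ is the set of indices of nonzero entries of a vector $x$; $e_k$ is the $k$-th standard basis vector of $\mathbb R^d$. $\otimes$ is the Kronecker product of vectors, $p^{\otimes n}$ the $n$-fold Kronecker power ($p^{\otimes 0}=(1)$), and $\oplus$ is concatenation of vectors. A stochastic map is (multiplication by) a matrix with non-negative entries all of whose columns sum to $1$. Let $A_+=\{\underline\alpha=(\alpha_1,\ldots,\alpha_d)\in\mathbb R^d : \alpha_1+\cdots+\alpha_d=1,\ \alpha_k\ge0\ \forall k\}$. Let $\mathcal I_d$ be the set of all pairs $(\underline\alpha,C)$ with $\underline\alpha\in A_+$ and $\operatorname{supp}\underline\alpha\subseteq C\subseteq[d]$, excluding the $d$ pairs $(e_k,\{k\})$, $k\in[d]$. For a tuple $P=(p^{(1)},\ldots,p^{(d)})$ of vectors in $\mathbb R_+^n$, with $p^{(k)}=(p^{(k)}_1,\ldots,p^{(k)}_n)$, define $$\Phi_{\underline\alpha,C}(P)=\sum_{i\in I(P,C)}\ \prod_{k\in\operatorname{supp}\underline\alpha}\big(p^{(k)}_i\big)^{\alpha_k},\qquad I(P,C)=\bigcap_{c\in C}\operatorname{supp}p^{(c)}.$$ *)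

theory Defs
  imports Complex_Main "Jordan_Normal_Form.Matrix"
begin

text \<open>All indices start at 0: a vector of length n has the index set {..<n}, and [d] is {..<d}.
  A d-tuple of vectors is a function P on the natural numbers of which only the values P k
  with k < d are relevant.\<close>

definition supp_vec :: "real vec \<Rightarrow> nat set" where
  "supp_vec x = {i. i < dim_vec x \<and> x $ i \<noteq> 0}"

definition prob_vec :: "nat \<Rightarrow> real vec \<Rightarrow> bool" where
  "prob_vec n x \<longleftrightarrow> x \<in> carrier_vec n \<and> (\<forall>i<n. 0 \<le> x $ i) \<and> (\<Sum>i<n. x $ i) = 1"

definition prob_tuple :: "nat \<Rightarrow> nat \<Rightarrow> (nat \<Rightarrow> real vec) \<Rightarrow> bool" where
  "prob_tuple d n P \<longleftrightarrow> (\<forall>k<d. prob_vec n (P k))"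

definition common_supp :: "(nat \<Rightarrow> real vec) \<Rightarrow> nat set \<Rightarrow> nat set" where
  "common_supp P C = (\<Inter>c\<in>C. supp_vec (P c))"

definition param_set :: "nat \<Rightarrow> (real vec \<times> nat set) set" where
  "param_set d = {(\<alpha>, C). prob_vec d \<alpha> \<and> supp_vec \<alpha> \<subseteq> C \<and> C \<subseteq> {..<d}}
     - {(unit_vec d k, {k}) | k. k < d}"

definition Phi :: "real vec \<Rightarrow> nat set \<Rightarrow> (nat \<Rightarrow> real vec) \<Rightarrow> real" where
  "Phi \<alpha> C P = (\<Sum>i\<in>common_supp P C. \<Prod>k\<in>supp_vec \<alpha>. (P k $ i) powr (\<alpha> $ k))"

definition stochastic_mat :: "real mat \<Rightarrow> bool" where
  "stochastic_mat T \<longleftrightarrow>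
     (\<forall>i<dim_row T. \<forall>j<dim_col T. 0 \<le> T $$ (i, j)) \<and>
     (\<forall>j<dim_col T. (\<Sum>i<dim_row T. T $$ (i, j)) = 1)"

definition kron_vec :: "real vec \<Rightarrow> real vec \<Rightarrow> real vec" (infixl \<open>\<otimes>\<^sub>v\<close> 70) where
  "u \<otimes>\<^sub>v v = vec (dim_vec u * dim_vec v) (\<lambda>i. u $ (i div dim_vec v) * v $ (i mod dim_vec v))"

primrec kron_pow :: "real vec \<Rightarrow> nat \<Rightarrow> real vec" where
  "kron_pow v 0 = vec 1 (\<lambda>_. 1)"
| "kron_pow v (Suc n) = v \<otimes>\<^sub>v kron_pow v n"

definition concat_vec :: "real vec list \<Rightarrow> real vec" where
  "concat_vec vs = foldr (@\<^sub>v) vs vNil"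

definition tuple_transform ::
    "nat \<Rightarrow> nat \<Rightarrow> nat \<Rightarrow> (nat \<Rightarrow> real vec) \<Rightarrow> (nat \<Rightarrow> real vec) \<Rightarrow> bool" where
  "tuple_transform d n m P Q \<longleftrightarrow>
     (\<exists>T \<in> carrier_mat m n. stochastic_mat T \<and> (\<forall>k<d. T *\<^sub>v P k = Q k))"

text \<open>Here P, Q and R consist of vectors of length n, m and l, respectively.\<close>

definition is_catalyst ::
    "nat \<Rightarrow> nat \<Rightarrow> nat \<Rightarrow> (nat \<Rightarrow> real vec) \<Rightarrow> (nat \<Rightarrow> real vec)
      \<Rightarrow> nat \<Rightarrow> (nat \<Rightarrow> real vec) \<Rightarrow> bool" where
  "is_catalyst d n m P Q l R \<longleftrightarrow>
     prob_tuple d l R \<and> common_supp R {..<d} \<noteq> {} \<and>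
     tuple_transform d (l * n) (l * m) (\<lambda>k. R k \<otimes>\<^sub>v P k) (\<lambda>k. R k \<otimes>\<^sub>v Q k)"

definition standard_catalyst :: "real vec \<Rightarrow> real vec \<Rightarrow> nat \<Rightarrow> real vec" where
  "standard_catalyst p q N =
     (1 / real (N + 1)) \<cdot>\<^sub>v
       concat_vec (map (\<lambda>j. kron_pow q j \<otimes>\<^sub>v kron_pow p (N - j)) [0..<N + 1])"

end

theory Submission
  imports Defs "HOL-Analysis.Function_Topology"
begin

text \<open>Taking \<alpha> to be a unit vector and C a pair shows that no P k is dominated by another P c, so
  that in the N-fold power most of the mass lies on outcomes seen by a single distribution. These outcomes
  can fill up any nonnegative remainder, and it suffices to place the outcomes seen by a set S of at least
  two distributions below the target. Such an outcome x is spread over the outcomes y of the power of Q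
  proportionally to the minimum over k in S of Q k (y) / a k, where a k is the mass that P k gives to
  the type class of x; altogether this uses a fraction of the target of at most the number of types
  (polynomial in N) divided by the least overlap, the overlap of x being the sum of these minima.
  By a Chernoff-type bound (tilt Q at the minimiser \<alpha> of its partition function and apply Chebyshev's inequality) each overlap is, up to a subexponential factor, at
  least the N-th power of \<Phi>(Q) divided by the product of the (a k) powr (\<alpha> k). That product is at
  most the N-th power of \<Phi>(P), and the strict inequalities leave an exponential gap, uniformly in \<alpha>
  since the closed simplex over S is compact. Conversely, \<Phi> is multiplicative, and it is monotone by the
  weighted arithmetic-geometric mean inequality.\<close>

section \<open>Kronecker products\<close>

text \<open>The pairs excluded from \<open>param_set\<close> are those at which both sides of the
  inequality equal 1, so a singleton \<open>C\<close> offers no exponential gap. This is why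
  outcomes seen by one distribution are not treated through overlaps but kept as filler;
  conservation of mass makes their total under each \<open>P k\<close> exactly the deficit of the
  target. The proportions solve an extremal problem: for given masses \<open>a k\<close>, the
  largest \<nu> with \<open>a k * \<nu> y \<le> Q k y\<close> for all \<open>k \<in> S\<close> is
  the pointwise minimum of the quotients. Normalising it divides by its total, the overlap, so one
  type class uses at most the reciprocal of the overlap as a fraction of each \<open>Q k\<close>.
  Words of one type have equal probabilities, so classes can be handled as wholes, and their
  polynomial number is absorbed by the exponential gap. The minimum runs over all of
  \<open>S\<close>, also over those k with \<alpha> k = 0. Hence \<alpha> must range over the closed
  simplex while the support condition stays tied to \<open>C\<close>, which is how \<open>C\<close>
  enters as a parameter besides \<alpha>.\<close>

lemma kron_dim [simp]: "dim_vec (u \<otimes>\<^sub>v v) = dim_vec u * dim_vec v"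
  by (simp add: kron_vec_def)

lemma kron_index:
  "i < dim_vec u * dim_vec v \<Longrightarrow> (u \<otimes>\<^sub>v v) $ i = u $ (i div dim_vec v) * v $ (i mod dim_vec v)"
  by (simp add: kron_vec_def)

text \<open>An index is a number in mixed radix, and both bracketings select the same three
  digits.\<close>

lemma kron_assoc: "(u \<otimes>\<^sub>v v) \<otimes>\<^sub>v w = u \<otimes>\<^sub>v (v \<otimes>\<^sub>v w)"
proof (rule eq_vecI)
  fix i assume "i < dim_vec (u \<otimes>\<^sub>v (v \<otimes>\<^sub>v w))"
  hence i: "i < dim_vec u * (dim_vec v * dim_vec w)" by simp
  hence pos: "0 < dim_vec w" "0 < dim_vec v" by (auto intro!: gr0I)
  have i': "i < dim_vec u * dim_vec v * dim_vec w" using i by (simp add: mult.assoc)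
  have 1: "i div dim_vec w < dim_vec u * dim_vec v" using i' by (rule less_mult_imp_div_less)
  have 2: "i mod (dim_vec v * dim_vec w) < dim_vec v * dim_vec w" using pos by simp
  have 3: "i mod (dim_vec v * dim_vec w) div dim_vec w = i div dim_vec w mod dim_vec v"
    by (metis mod_mult2_eq mult.commute div_mult_self4 mod_less_divisor div_less pos(1) add_0_right neq0_conv)
  have 4: "i mod (dim_vec v * dim_vec w) mod dim_vec w = i mod dim_vec w"
    by (simp add: mod_mod_cancel)
  have 5: "i div (dim_vec v * dim_vec w) = i div dim_vec w div dim_vec v"
    by (metis div_mult2_eq mult.commute)
  show "((u \<otimes>\<^sub>v v) \<otimes>\<^sub>v w) $ i = (u \<otimes>\<^sub>v (v \<otimes>\<^sub>v w)) $ i"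
    using i i' 1 2 by (simp add: kron_index 3 4 5)
qed (simp add: mult.assoc)

lemma kron_one_right [simp]: "v \<otimes>\<^sub>v vec (Suc 0) (\<lambda>_. 1) = v"
  by (rule eq_vecI) (auto simp: kron_index)

lemma kron_one_left [simp]: "vec (Suc 0) (\<lambda>_. 1) \<otimes>\<^sub>v v = v"
  by (rule eq_vecI) (auto simp: kron_index)

lemma kron_pow_commute: "kron_pow v a \<otimes>\<^sub>v v = v \<otimes>\<^sub>v kron_pow v a"
  by (induction a) (simp_all add: kron_assoc)

lemma dim_kron_pow [simp]: "dim_vec (kron_pow v N) = dim_vec v ^ N"
  by (induction N) auto

text \<open>The left factor supplies the leading digit of the index, so a concatenation there cuts
  the index range into two intervals. In the right factor the analogous law would hold only up to a
  permutation.\<close>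

lemma kron_append: "(u @\<^sub>v v) \<otimes>\<^sub>v w = (u \<otimes>\<^sub>v w) @\<^sub>v (v \<otimes>\<^sub>v w)"
proof (rule eq_vecI)
  fix i assume "i < dim_vec ((u \<otimes>\<^sub>v w) @\<^sub>v (v \<otimes>\<^sub>v w))"
  hence i: "i < (dim_vec u + dim_vec v) * dim_vec w" by (simp add: algebra_simps)
  hence pos: "0 < dim_vec w" by (auto intro!: gr0I)
  have 1: "i div dim_vec w < dim_vec u + dim_vec v" using i by (rule less_mult_imp_div_less)
  have 2: "i div dim_vec w < dim_vec u \<longleftrightarrow> i < dim_vec u * dim_vec w"
    using pos by (simp add: div_less_iff_less_mult)
  have 3: "(i - dim_vec u * dim_vec w) div dim_vec w = i div dim_vec w - dim_vec u"
    "(i - dim_vec u * dim_vec w) mod dim_vec w = i mod dim_vec w"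
    if ge: "\<not> i < dim_vec u * dim_vec w"
  proof -
    obtain j where "i = dim_vec u * dim_vec w + j"
      using ge by (auto simp: not_less le_iff_add)
    then show "(i - dim_vec u * dim_vec w) div dim_vec w = i div dim_vec w - dim_vec u"
      "(i - dim_vec u * dim_vec w) mod dim_vec w = i mod dim_vec w"
      using div_mult_self3[of "dim_vec w" "dim_vec u" j] mod_mult_self3[of "dim_vec u" "dim_vec w" j] pos
      unfolding \<open>i = _\<close> by (metis diff_add_inverse less_irrefl)+
  qed
  show "((u @\<^sub>v v) \<otimes>\<^sub>v w) $ i = ((u \<otimes>\<^sub>v w) @\<^sub>v (v \<otimes>\<^sub>v w)) $ i"
    using i 1 2 3 by (cases "i < dim_vec u * dim_vec w") (simp_all add: kron_index add_mult_distrib less_diff_conv2)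
qed (simp add: algebra_simps)

section \<open>Concatenation of lists of vectors\<close>

lemma concat_vec_simps [simp]:
  "concat_vec [] = vNil" "concat_vec (v # vs) = v @\<^sub>v concat_vec vs"
  by (simp_all add: concat_vec_def)

lemma append_vNil_right [simp]: "v @\<^sub>v vNil = v"
  by (rule eq_vecI) auto

lemma append_vNil_left [simp]: "vNil @\<^sub>v v = v"
  by (rule eq_vecI) auto

lemma append_vec_assoc': "(u @\<^sub>v v) @\<^sub>v w = u @\<^sub>v (v @\<^sub>v w)"
  by (rule eq_vecI) (auto simp: algebra_simps)

lemma concat_vec_append: "concat_vec (xs @ ys) = concat_vec xs @\<^sub>v concat_vec ys"
  by (induction xs) (auto simp: append_vec_assoc')

lemma kron_concat: "concat_vec vs \<otimes>\<^sub>v w = concat_vec (map (\<lambda>v. v \<otimes>\<^sub>v w) vs)"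
proof (induction vs)
  case Nil
  show ?case by (rule eq_vecI) (auto simp: kron_vec_def)
qed (simp add: kron_append)

lemma dim_concat_vec: "dim_vec (concat_vec vs) = sum_list (map dim_vec vs)"
  by (induction vs) auto

lemma kron_smult_left: "(c \<cdot>\<^sub>v u) \<otimes>\<^sub>v v = c \<cdot>\<^sub>v (u \<otimes>\<^sub>v v)"
  by (rule eq_vecI) (auto simp: kron_index less_mult_imp_div_less)

section \<open>Product indices and Kronecker products of probability vectors\<close>

lemma sum_nat_times:
  fixes f :: "nat \<Rightarrow> 'a::comm_monoid_add"
  shows "(\<Sum>i<a * b. f i) = (\<Sum>i<a. \<Sum>j<b. f (i * b + j))"
proof -
  have "(\<Sum>i<a * b. f i) = (\<Sum>i<a. sum f {i * b..<i * b + b})"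
    using sum.nat_group[of f b a] by simp
  also have "\<dots> = (\<Sum>i<a. \<Sum>j<b. f (i * b + j))"
  proof (rule sum.cong [OF refl])
    fix i
    show "sum f {i * b..<i * b + b} = (\<Sum>j<b. f (i * b + j))"
      using sum.shift_bounds_nat_ivl[of f 0 "i * b" b]
      by (simp add: atLeast0LessThan add.commute)
  qed
  finally show ?thesis .
qed

lemma add_mult_less:
  assumes "i < a" and "j < (b::nat)"
  shows "i * b + j < a * b"
proof -
  have "i * b + j < Suc i * b" using assms by simp
  also have "\<dots> \<le> a * b" using assms by (intro mult_right_mono) auto
  finally show ?thesis .
qed

lemma kron_index_pair:
  assumes "i < dim_vec u" and "j < dim_vec v"
  shows "(u \<otimes>\<^sub>v v) $ (i * dim_vec v + j) = u $ i * v $ j"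
proof -
  have "dim_vec v \<noteq> 0" using assms by auto
  then have "(i * dim_vec v + j) div dim_vec v = i"
    using assms div_mult_self3[of "dim_vec v" i j] by simp
  then show ?thesis using assms by (simp add: kron_index add_mult_less)
qed

lemma prob_vec_kron:
  assumes "prob_vec a u" and "prob_vec b v"
  shows "prob_vec (a * b) (u \<otimes>\<^sub>v v)"
proof -
  have d: "dim_vec u = a" "dim_vec v = b" using assms by (auto simp: prob_vec_def)
  have nonneg: "0 \<le> (u \<otimes>\<^sub>v v) $ i" if "i < a * b" for i
  proof -
    have "i div b < a" "i mod b < b"
      using that by (auto simp: less_mult_imp_div_less intro!: mod_less_divisor gr0I)
    then have "0 \<le> u $ (i div b)" "0 \<le> v $ (i mod b)" using assms by (auto simp: prob_vec_def)
    then show ?thesis using that d by (simp add: kron_index)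
  qed
  have sum1: "(\<Sum>i<a * b. (u \<otimes>\<^sub>v v) $ i) = 1"
  proof -
    have "(\<Sum>i<a * b. (u \<otimes>\<^sub>v v) $ i) = (\<Sum>i<a. \<Sum>j<b. u $ i * v $ j)"
      unfolding sum_nat_times using d kron_index_pair[of _ u _ v] by (intro sum.cong) auto
    also have "\<dots> = (\<Sum>i<a. u $ i) * (\<Sum>j<b. v $ j)"
      by (rule sum_product [symmetric])
    finally show ?thesis using assms by (simp add: prob_vec_def)
  qed
  show ?thesis
    unfolding prob_vec_def by (intro conjI allI impI carrier_vecI nonneg sum1) (simp add: d)
qed

lemma prob_vec_kron_pow: "prob_vec a u \<Longrightarrow> prob_vec (a ^ N) (kron_pow u N)"
proof (induction N)
  case 0
  then show ?case by (simp add: prob_vec_def)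
next
  case (Suc N)
  then show ?case by (simp add: prob_vec_kron)
qed

lemma bij_betw_kron_index:
  "bij_betw (\<lambda>(i, j). i * b + j) ({..<a} \<times> {..<b}) {..<a * (b::nat)}"
proof (rule bij_betw_byWitness[where f' = "\<lambda>i. (i div b, i mod b)"])
  show "(\<lambda>i. (i div b, i mod b)) ` {..<a * b} \<subseteq> {..<a} \<times> {..<b}"
    by (auto simp: less_mult_imp_div_less intro!: mod_less_divisor gr0I)
qed (auto simp: add_mult_less)

section \<open>Simultaneous stochastic maps\<close>

text \<open>Kernels are built on index sets that suit the problem, such as pairs or words, and
  numbered only here. \<open>T x y\<close> is the probability of passing from x to y, so its
  arguments are transposed against those of the matrix.\<close>

lemma tuple_transformI:
  assumes e: "bij_betw e X {..<n}" and e': "bij_betw e' Y {..<m}"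
    and dim: "\<And>k. k < d \<Longrightarrow> dim_vec (P k) = n" "\<And>k. k < d \<Longrightarrow> dim_vec (Q k) = m"
    and nonneg: "\<And>x y. x \<in> X \<Longrightarrow> y \<in> Y \<Longrightarrow> 0 \<le> T x y"
    and sum1: "\<And>x. x \<in> X \<Longrightarrow> (\<Sum>y\<in>Y. T x y) = 1"
    and act: "\<And>k y. k < d \<Longrightarrow> y \<in> Y \<Longrightarrow> (\<Sum>x\<in>X. T x y * P k $ e x) = Q k $ e' y"
  shows "tuple_transform d n m P Q"
proof -
  define f where "f = inv_into X e"
  define f' where "f' = inv_into Y e'"
  have f: "bij_betw f {..<n} X" and f': "bij_betw f' {..<m} Y"
    using e e' by (auto simp: f_def f'_def bij_betw_inv_into)
  have ef: "e (f i) = i" if "i < n" for i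
    using e that by (auto simp: f_def bij_betw_inv_into_right)
  have ef': "e' (f' i) = i" if "i < m" for i
    using e' that by (auto simp: f'_def bij_betw_inv_into_right)
  define M where "M = mat m n (\<lambda>(i, j). T (f j) (f' i))"
  have fX: "f j \<in> X" if "j < n" for j using f that by (auto simp: bij_betw_def)
  have fY: "f' j \<in> Y" if "j < m" for j using f' that by (auto simp: bij_betw_def)
  have "stochastic_mat M"
    unfolding stochastic_mat_def
  proof (intro conjI allI impI)
    fix j assume "j < dim_col M"
    hence j: "j < n" by (simp add: M_def)
    have "(\<Sum>i<dim_row M. M $$ (i, j)) = (\<Sum>i<m. T (f j) (f' i))"
      using j by (simp add: M_def)
    also have "\<dots> = 1"
      using sum.reindex_bij_betw[OF f', of "T (f j)"] sum1[OF fX[OF j]] by simp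
    finally show "(\<Sum>i<dim_row M. M $$ (i, j)) = 1" .
  qed (auto simp: M_def nonneg fX fY)
  moreover have "M *\<^sub>v P k = Q k" if k: "k < d" for k
  proof (rule eq_vecI)
    fix i assume "i < dim_vec (Q k)"
    hence i: "i < m" by (simp add: dim k)
    have "(M *\<^sub>v P k) $ i = (\<Sum>j<n. T (f j) (f' i) * P k $ e (f j))"
      using i by (simp add: M_def scalar_prod_def dim k ef atLeast0LessThan)
    also have "\<dots> = Q k $ i"
      using sum.reindex_bij_betw[OF f, of "\<lambda>x. T x (f' i) * P k $ e x"]
        act[OF k fY[OF i]] ef'[OF i] by simp
    finally show "(M *\<^sub>v P k) $ i = Q k $ i" .
  qed (simp add: M_def dim k)
  ultimately show ?thesis
    by (auto simp: tuple_transform_def M_def intro!: bexI[where x = M])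
qed

lemma tuple_transformE:
  assumes "tuple_transform d n m P Q" and "\<And>k. k < d \<Longrightarrow> dim_vec (P k) = n"
  obtains T where "\<And>i j. i < n \<Longrightarrow> j < m \<Longrightarrow> 0 \<le> T i j"
    and "\<And>i. i < n \<Longrightarrow> (\<Sum>j<m. T i j) = (1::real)"
    and "\<And>k j. k < d \<Longrightarrow> j < m \<Longrightarrow> (\<Sum>i<n. T i j * P k $ i) = Q k $ j"
    and "\<And>k. k < d \<Longrightarrow> dim_vec (Q k) = m"
proof -
  obtain M where M: "M \<in> carrier_mat m n" "stochastic_mat M" "\<And>k. k < d \<Longrightarrow> M *\<^sub>v P k = Q k"
    using assms by (auto simp: tuple_transform_def)
  show ?thesis
  proof (rule that[of "\<lambda>i j. M $$ (j, i)"])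
    fix k j assume kj: "k < d" "j < m"
    show "(\<Sum>i<n. M $$ (j, i) * P k $ i) = Q k $ j"
      using M kj assms(2)[of k]
      by (simp flip: M(3)) (simp add: scalar_prod_def atLeast0LessThan)
  next
    fix k assume "k < d"
    then show "dim_vec (Q k) = m" using M by (metis carrier_matD(1) dim_mult_mat_vec)
  qed (use M in \<open>auto simp: stochastic_mat_def\<close>)
qed

lemma tuple_transform_reindex:
  assumes f: "bij_betw f {..<n} {..<n}"
    and dim: "\<And>k. k < d \<Longrightarrow> dim_vec (P k) = n" "\<And>k. k < d \<Longrightarrow> dim_vec (Q k) = n"
    and PQ: "\<And>k i. k < d \<Longrightarrow> i < n \<Longrightarrow> Q k $ f i = P k $ i"
  shows "tuple_transform d n n P Q"
proof (rule tuple_transformI[where e = id and e' = f and X = "{..<n}" and Y = "{..<n}"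
      and T = "\<lambda>x y. if x = y then 1 else 0"])
  fix k y assume "k < d" "y \<in> {..<n}"
  then show "(\<Sum>x<n. (if x = y then 1 else 0) * P k $ id x) = Q k $ f y"
    using PQ by (simp add: if_distrib[of "\<lambda>a. a * _"] cong: if_cong)
qed (use f dim in auto)

lemma tuple_transform_refl:
  "(\<And>k. k < d \<Longrightarrow> dim_vec (P k) = n) \<Longrightarrow> tuple_transform d n n P P"
  by (rule tuple_transform_reindex[of id]) auto

lemma tuple_transform_trans:
  assumes PQ: "tuple_transform d n m P Q" and QR: "tuple_transform d m l Q R"
    and dim: "\<And>k. k < d \<Longrightarrow> dim_vec (P k) = n"
  shows "tuple_transform d n l P R"
proof -
  obtain T where T: "\<And>i j. i < n \<Longrightarrow> j < m \<Longrightarrow> 0 \<le> T i j"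
    "\<And>i. i < n \<Longrightarrow> (\<Sum>j<m. T i j) = (1::real)"
    "\<And>k j. k < d \<Longrightarrow> j < m \<Longrightarrow> (\<Sum>i<n. T i j * P k $ i) = Q k $ j"
    and dQ: "\<And>k. k < d \<Longrightarrow> dim_vec (Q k) = m"
    using tuple_transformE[OF PQ dim] by blast
  obtain U where U: "\<And>i j. i < m \<Longrightarrow> j < l \<Longrightarrow> 0 \<le> U i j"
    "\<And>i. i < m \<Longrightarrow> (\<Sum>j<l. U i j) = (1::real)"
    "\<And>k j. k < d \<Longrightarrow> j < l \<Longrightarrow> (\<Sum>i<m. U i j * Q k $ i) = R k $ j"
    and dR: "\<And>k. k < d \<Longrightarrow> dim_vec (R k) = l"
    using tuple_transformE[OF QR dQ] by blast
  show ?thesis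
  proof (rule tuple_transformI[where e = id and e' = id and X = "{..<n}" and Y = "{..<l}"
      and T = "\<lambda>x z. \<Sum>y<m. T x y * U y z"])
    fix x assume "x \<in> {..<n}"
    have "(\<Sum>z<l. \<Sum>y<m. T x y * U y z) = (\<Sum>y<m. T x y * (\<Sum>z<l. U y z))"
      by (subst sum.swap) (simp add: sum_distrib_left)
    also have "\<dots> = 1" using T U \<open>x \<in> {..<n}\<close> by simp
    finally show "(\<Sum>z<l. \<Sum>y<m. T x y * U y z) = 1" .
  next
    fix k z assume kz: "k < d" "z \<in> {..<l}"
    have "(\<Sum>x<n. (\<Sum>y<m. T x y * U y z) * P k $ id x)
        = (\<Sum>y<m. U y z * (\<Sum>x<n. T x y * P k $ x))"
      by (simp add: sum_distrib_left sum_distrib_right mult_ac) (rule sum.swap)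
    also have "\<dots> = R k $ z" using T U kz by simp
    finally show "(\<Sum>x<n. (\<Sum>y<m. T x y * U y z) * P k $ id x) = R k $ id z" by simp
  qed (use dim dR T U in \<open>auto intro!: sum_nonneg\<close>)
qed

lemma tuple_transform_smult:
  assumes "tuple_transform d n m P Q" and "\<And>k. k < d \<Longrightarrow> dim_vec (P k) = n"
  shows "tuple_transform d n m (\<lambda>k. c \<cdot>\<^sub>v P k) (\<lambda>k. c \<cdot>\<^sub>v Q k)"
proof -
  obtain T where T: "T \<in> carrier_mat m n" "stochastic_mat T" "\<forall>k<d. T *\<^sub>v P k = Q k"
    using assms by (auto simp: tuple_transform_def)
  have *: "T *\<^sub>v (c \<cdot>\<^sub>v P k) = c \<cdot>\<^sub>v Q k" if "k < d" for k
  proof -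
    have "P k \<in> carrier_vec n" using assms(2)[OF that] by (rule carrier_vecI)
    then have "T *\<^sub>v (c \<cdot>\<^sub>v P k) = c \<cdot>\<^sub>v (T *\<^sub>v P k)"
      by (rule mult_mat_vec [OF T(1)])
    also have "T *\<^sub>v P k = Q k" using T(3) that by blast
    finally show ?thesis .
  qed
  show ?thesis unfolding tuple_transform_def using T(1,2) * by blast
qed

lemma sum_nat_add:
  fixes f :: "nat \<Rightarrow> 'a::comm_monoid_add"
  shows "(\<Sum>i<a + b. f i) = (\<Sum>i<a. f i) + (\<Sum>i<b. f (a + i))"
proof (induction b)
  case (Suc b)
  then show ?case by (simp add: add.assoc)
qed simp

lemma tuple_transform_append:
  assumes 1: "tuple_transform d n m P Q" and 2: "tuple_transform d n' m' P' Q'"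
    and dim: "\<And>k. k < d \<Longrightarrow> dim_vec (P k) = n" "\<And>k. k < d \<Longrightarrow> dim_vec (P' k) = n'"
  shows "tuple_transform d (n + n') (m + m') (\<lambda>k. P k @\<^sub>v P' k) (\<lambda>k. Q k @\<^sub>v Q' k)"
proof -
  obtain T where T: "\<And>i j. i < n \<Longrightarrow> j < m \<Longrightarrow> 0 \<le> T i j"
    "\<And>i. i < n \<Longrightarrow> (\<Sum>j<m. T i j) = (1::real)"
    "\<And>k j. k < d \<Longrightarrow> j < m \<Longrightarrow> (\<Sum>i<n. T i j * P k $ i) = Q k $ j"
    and dQ: "\<And>k. k < d \<Longrightarrow> dim_vec (Q k) = m"
    using tuple_transformE[OF 1 dim(1)] by blast
  obtain U where U: "\<And>i j. i < n' \<Longrightarrow> j < m' \<Longrightarrow> 0 \<le> U i j"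
    "\<And>i. i < n' \<Longrightarrow> (\<Sum>j<m'. U i j) = (1::real)"
    "\<And>k j. k < d \<Longrightarrow> j < m' \<Longrightarrow> (\<Sum>i<n'. U i j * P' k $ i) = Q' k $ j"
    and dQ': "\<And>k. k < d \<Longrightarrow> dim_vec (Q' k) = m'"
    using tuple_transformE[OF 2 dim(2)] by blast
  \<comment> \<open>The block diagonal sum of the two kernels.\<close>
  define V where "V x y = (if x < n \<and> y < m then T x y
    else if \<not> x < n \<and> \<not> y < m then U (x - n) (y - m) else 0)" for x y
  show ?thesis
  proof (rule tuple_transformI[where e = id and e' = id and X = "{..<n + n'}" and Y = "{..<m + m'}"
      and T = V])
    fix x assume x: "x \<in> {..<n + n'}"
    then show "sum (V x) {..<m + m'} = 1"
      using T(2)[of x] U(2)[of "x - n"] by (cases "x < n") (simp_all add: V_def sum_nat_add)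
  next
    fix k y assume ky: "k < d" "y \<in> {..<m + m'}"
    then show "(\<Sum>x<n + n'. V x y * (P k @\<^sub>v P' k) $ id x) = (Q k @\<^sub>v Q' k) $ id y"
      using T(3)[of k y] U(3)[of k "y - m"] dim[OF ky(1)] dQ[OF ky(1)] dQ'[OF ky(1)]
      by (cases "y < m") (simp_all add: V_def sum_nat_add)
  qed (use dim dQ dQ' T U in \<open>auto simp: V_def\<close>)
qed

lemma tuple_transform_append_commute:
  assumes dim: "\<And>k. k < d \<Longrightarrow> dim_vec (P k) = n" "\<And>k. k < d \<Longrightarrow> dim_vec (Q k) = m"
  shows "tuple_transform d (n + m) (n + m) (\<lambda>k. P k @\<^sub>v Q k) (\<lambda>k. Q k @\<^sub>v P k)"
proof (rule tuple_transform_reindex)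
  show "bij_betw (\<lambda>i. if i < n then i + m else i - n) {..<n + m} {..<n + m}"
    by (rule bij_betw_byWitness[where f' = "\<lambda>i. if i < m then i + n else i - m"]) auto
qed (use dim in auto)

lemma tuple_transform_kron_commute:
  assumes dim: "\<And>k. k < d \<Longrightarrow> dim_vec (P k) = n" "\<And>k. k < d \<Longrightarrow> dim_vec (Q k) = m"
  shows "tuple_transform d (n * m) (n * m) (\<lambda>k. P k \<otimes>\<^sub>v Q k) (\<lambda>k. Q k \<otimes>\<^sub>v P k)"
proof -
  \<comment> \<open>Both products are indexed by the same pairs, numbered in two ways; the identity
    kernel on pairs then becomes the required permutation matrix.\<close>
  let ?e = "\<lambda>(i, j). i * m + j" and ?e' = "\<lambda>(i, j). j * n + i"
  have "bij_betw prod.swap ({..<n} \<times> {..<m}) ({..<m} \<times> {..<n})"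
    by (auto intro: bij_betw_byWitness[where f' = prod.swap])
  from bij_betw_trans[OF this bij_betw_kron_index[of n m]]
  have e': "bij_betw ?e' ({..<n} \<times> {..<m}) {..<n * m}"
    by (simp add: comp_def case_prod_unfold mult.commute)
  show ?thesis
  proof (rule tuple_transformI[OF bij_betw_kron_index e', where T = "\<lambda>x y. if x = y then 1 else 0"])
    fix k y assume ky: "k < d" "y \<in> {..<n} \<times> {..<m}"
    then obtain i j where y: "y = (i, j)" "i < n" "j < m" by auto
    have "(\<Sum>x\<in>{..<n} \<times> {..<m}. (if x = y then 1 else 0) * (P k \<otimes>\<^sub>v Q k) $ ?e x)
        = (\<Sum>x\<in>{..<n} \<times> {..<m}. if x = y then (P k \<otimes>\<^sub>v Q k) $ ?e x else 0)"
      by (rule sum.cong) auto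
    also have "\<dots> = (Q k \<otimes>\<^sub>v P k) $ ?e' y"
      using ky y dim[OF ky(1)] kron_index_pair[of i "P k" j "Q k"] kron_index_pair[of j "Q k" i "P k"]
      by simp
    finally show "(\<Sum>x\<in>{..<n} \<times> {..<m}. (if x = y then 1 else 0) * (P k \<otimes>\<^sub>v Q k) $ ?e x)
        = (Q k \<otimes>\<^sub>v P k) $ ?e' y" .
  qed (auto simp: dim)
qed

lemma tuple_transform_concat:
  assumes "\<And>j. j \<in> set js \<Longrightarrow> tuple_transform d (a j) (b j) (\<lambda>k. F k j) (\<lambda>k. G k j)"
    and "\<And>k j. k < d \<Longrightarrow> j \<in> set js \<Longrightarrow> dim_vec (F k j) = a j"
  shows "tuple_transform d (sum_list (map a js)) (sum_list (map b js))
    (\<lambda>k. concat_vec (map (F k) js)) (\<lambda>k. concat_vec (map (G k) js))"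
  using assms
proof (induction js)
  case Nil
  show ?case by (auto intro: tuple_transform_refl)
next
  case (Cons j js)
  have "tuple_transform d (a j + sum_list (map a js)) (b j + sum_list (map b js))
    (\<lambda>k. F k j @\<^sub>v concat_vec (map (F k) js)) (\<lambda>k. G k j @\<^sub>v concat_vec (map (G k) js))"
  proof (rule tuple_transform_append)
    show "dim_vec (concat_vec (map (F k) js)) = sum_list (map a js)" if "k < d" for k
      using Cons.prems(2)[OF that]
      by (auto simp: dim_concat_vec comp_def intro!: arg_cong[where f = sum_list])
  qed (use Cons in auto)
  then show ?case by simp
qed

section \<open>The standard catalyst\<close>

lemma supp_vec_append: "supp_vec u \<subseteq> supp_vec (u @\<^sub>v v)"
  by (auto simp: supp_vec_def)

lemma supp_vec_smult: "c \<noteq> 0 \<Longrightarrow> supp_vec (c \<cdot>\<^sub>v v) = supp_vec v"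
  by (auto simp: supp_vec_def)

lemma mem_supp_vec_kron:
  "i < dim_vec u \<Longrightarrow> j < dim_vec v \<Longrightarrow>
    i * dim_vec v + j \<in> supp_vec (u \<otimes>\<^sub>v v) \<longleftrightarrow> i \<in> supp_vec u \<and> j \<in> supp_vec v"
  by (simp add: supp_vec_def kron_index_pair add_mult_less)

lemma common_supp_kron:
  assumes "i \<in> common_supp P I" and "j \<in> common_supp Q I"
    and "\<And>k. k \<in> I \<Longrightarrow> dim_vec (Q k) = m"
  shows "i * m + j \<in> common_supp (\<lambda>k. P k \<otimes>\<^sub>v Q k) I"
  unfolding common_supp_def
proof
  fix k assume k: "k \<in> I"
  have "i \<in> supp_vec (P k)" "j \<in> supp_vec (Q k)"
    using assms(1,2) k by (auto simp: common_supp_def)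
  then show "i * m + j \<in> supp_vec (P k \<otimes>\<^sub>v Q k)"
    using mem_supp_vec_kron[of i "P k" j "Q k"] assms(3)[OF k] by (simp add: supp_vec_def)
qed

lemma common_supp_kron_pow:
  assumes "common_supp P I \<noteq> {}" and dim: "\<And>k. k \<in> I \<Longrightarrow> dim_vec (P k) = n"
  shows "common_supp (\<lambda>k. kron_pow (P k) N) I \<noteq> {}"
proof (induction N)
  case 0
  show ?case by (auto simp: common_supp_def supp_vec_def)
next
  case (Suc N)
  then obtain j where "j \<in> common_supp (\<lambda>k. kron_pow (P k) N) I" by blast
  moreover obtain i where "i \<in> common_supp P I" using assms by blast
  ultimately show ?case
    using common_supp_kron[of i P I j "\<lambda>k. kron_pow (P k) N" "n ^ N"] dim by auto
qed

text \<open>Every block has mass 1, so the mass counts the blocks; this is the source of the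
  normalisation by \<open>N + 1\<close> in the catalyst.\<close>

lemma concat_prob_vec:
  assumes "\<And>v. v \<in> set vs \<Longrightarrow> \<exists>l. prob_vec l v"
  shows "(\<forall>i<dim_vec (concat_vec vs). 0 \<le> concat_vec vs $ i) \<and>
    (\<Sum>i<dim_vec (concat_vec vs). concat_vec vs $ i) = real (length vs)"
  using assms
proof (induction vs)
  case (Cons v vs)
  obtain l where l: "prob_vec l v" using Cons.prems by auto
  then have [simp]: "dim_vec v = l" by (simp add: prob_vec_def)
  have "(\<Sum>i<l + dim_vec (concat_vec vs). (v @\<^sub>v concat_vec vs) $ i) = real (length (v # vs))"
    using Cons l by (simp add: sum_nat_add prob_vec_def)
  then show ?case using Cons l by (auto simp: prob_vec_def)
qed simp

lemma prob_vec_standard_catalyst: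
  assumes "prob_vec n p" and "prob_vec m q"
  shows "prob_vec (\<Sum>j\<leftarrow>[0..<N + 1]. m ^ j * n ^ (N - j)) (standard_catalyst p q N)"
proof -
  define vs where "vs = map (\<lambda>j. kron_pow q j \<otimes>\<^sub>v kron_pow p (N - j)) [0..<N + 1]"
  have dims: "dim_vec p = n" "dim_vec q = m" using assms by (auto simp: prob_vec_def)
  have "\<exists>l. prob_vec l v" if v: "v \<in> set vs" for v
  proof -
    obtain j where "v = kron_pow q j \<otimes>\<^sub>v kron_pow p (N - j)"
      using v unfolding vs_def set_map by blast
    then show ?thesis using prob_vec_kron prob_vec_kron_pow assms by blast
  qed
  from concat_prob_vec[of vs, OF this]
  have vs: "\<forall>i<dim_vec (concat_vec vs). 0 \<le> concat_vec vs $ i"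
    "(\<Sum>i<dim_vec (concat_vec vs). concat_vec vs $ i) = real (N + 1)"
    by (simp_all only: vs_def length_map length_upt) auto
  have dim: "dim_vec (concat_vec vs) = (\<Sum>j\<leftarrow>[0..<N + 1]. m ^ j * n ^ (N - j))"
    unfolding dim_concat_vec vs_def map_map comp_def by (simp add: dims)
  have "(\<Sum>i<dim_vec (concat_vec vs). (1 / real (N + 1) \<cdot>\<^sub>v concat_vec vs) $ i)
      = 1 / real (N + 1) * (\<Sum>i<dim_vec (concat_vec vs). concat_vec vs $ i)"
    by (simp add: sum_distrib_left)
  also have "\<dots> = 1" unfolding vs(2) by simp
  finally have "prob_vec (dim_vec (concat_vec vs)) (1 / real (N + 1) \<cdot>\<^sub>v concat_vec vs)"
    unfolding prob_vec_def using vs(1) by (auto intro!: carrier_vecI)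
  then show ?thesis by (simp only: standard_catalyst_def vs_def dim [unfolded vs_def])
qed

text \<open>The block with index 0 is the plain power of \<open>P k\<close> and stands first, so a
  common index of these powers is, unshifted, a common index of the catalysts.\<close>

lemma common_supp_standard_catalyst:
  assumes "common_supp P I \<noteq> {}" and "\<And>k. k \<in> I \<Longrightarrow> dim_vec (P k) = n"
  shows "common_supp (\<lambda>k. standard_catalyst (P k) (Q k) N) I \<noteq> {}"
proof -
  have "supp_vec (kron_pow p N) \<subseteq> supp_vec (standard_catalyst p q N)" for p q
    by (simp add: standard_catalyst_def supp_vec_smult supp_vec_append upt_conv_Cons
        del: upt_Suc)
  then have "common_supp (\<lambda>k. kron_pow (P k) N) I
      \<subseteq> common_supp (\<lambda>k. standard_catalyst (P k) (Q k) N) I"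
    by (auto simp: common_supp_def)
  then show ?thesis using common_supp_kron_pow[OF assms] by blast
qed

text \<open>Tensoring the catalyst with the input or with the output telescopes: the two results share all
  blocks except for one, which is the (N + 1)-st power of the input or of the output.\<close>
lemma is_catalyst_standard_catalyst:
  assumes P: "prob_tuple d n P" and Q: "prob_tuple d m Q" and supp: "common_supp P {..<d} \<noteq> {}"
    and T: "tuple_transform d (n ^ Suc N) (m ^ Suc N)
      (\<lambda>k. kron_pow (P k) (Suc N)) (\<lambda>k. kron_pow (Q k) (Suc N))"
  shows "is_catalyst d n m P Q (\<Sum>j\<leftarrow>[0..<N + 1]. m ^ j * n ^ (N - j))
    (\<lambda>k. standard_catalyst (P k) (Q k) N)"
proof -
  define l where "l = (\<Sum>j\<leftarrow>[0..<N + 1]. m ^ j * n ^ (N - j))"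
  define V where "V k j = kron_pow (Q k) j \<otimes>\<^sub>v kron_pow (P k) (N - j)" for k j
  \<comment> \<open>\<open>V\<close> lists the blocks of the unnormalised catalyst; \<open>W\<close>
    lists the blocks of total degree \<open>N + 1\<close>. Multiplying \<open>V k j\<close> by
    \<open>P k\<close> gives \<open>W k j\<close>, multiplying it by \<open>Q k\<close> gives
    \<open>W k (Suc j)\<close> up to order of factors.\<close>
  define W where "W k j = kron_pow (Q k) j \<otimes>\<^sub>v kron_pow (P k) (Suc N - j)" for k j
  define w where "w j = m ^ j * n ^ (Suc N - j)" for j
  define s where "s = sum_list (map w [Suc 0..<Suc N])"
  have dimP: "dim_vec (P k) = n" and dimQ: "dim_vec (Q k) = m" if "k < d" for k
    using P Q that by (auto simp: prob_tuple_def prob_vec_def)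
  have dimW: "dim_vec (W k j) = w j" if "k < d" for k j
    using that by (simp add: W_def w_def dimP dimQ)
  have dim_concat: "dim_vec (concat_vec (map (W k) js)) = sum_list (map w js)" if "k < d" for k js
    by (simp add: dim_concat_vec comp_def dimW that)
  have upt0: "[0..<N + 1] = 0 # [Suc 0..<Suc N]" by (simp add: upt_conv_Cons del: upt_Suc)
  have upt_snoc: "map Suc [0..<N + 1] = [Suc 0..<Suc N] @ [Suc N]"
    by (simp add: map_Suc_upt)
  \<comment> \<open>The bound on j matters: \<open>Suc N - j\<close> equals
    \<open>Suc (N - j)\<close> only for \<open>j \<le> N\<close>, because subtraction is
    truncated.\<close>
  have VP: "V k j \<otimes>\<^sub>v P k = W k j" if "j \<in> set [0..<N + 1]" for k j
    using that by (auto simp: V_def W_def kron_assoc kron_pow_commute Suc_diff_le simp flip: kron_pow.simps)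
  have VQ: "Q k \<otimes>\<^sub>v V k j = W k (Suc j)" for k j
    by (simp add: V_def W_def kron_assoc)
  have "tuple_transform d (n ^ Suc N + s) (m ^ Suc N + s)
      (\<lambda>k. kron_pow (P k) (Suc N) @\<^sub>v concat_vec (map (W k) [Suc 0..<Suc N]))
      (\<lambda>k. kron_pow (Q k) (Suc N) @\<^sub>v concat_vec (map (W k) [Suc 0..<Suc N]))"
    unfolding s_def
    by (intro tuple_transform_append T tuple_transform_refl dim_concat) (simp_all add: dimP)
  \<comment> \<open>The power of \<open>Q k\<close> replaces block 0 but is itself the block with
    index \<open>N + 1\<close>, so it has to move from the front to the end.\<close>
  moreover have "tuple_transform d (m ^ Suc N + s) (m ^ Suc N + s)
      (\<lambda>k. kron_pow (Q k) (Suc N) @\<^sub>v concat_vec (map (W k) [Suc 0..<Suc N]))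
      (\<lambda>k. concat_vec (map (W k) [Suc 0..<Suc N]) @\<^sub>v kron_pow (Q k) (Suc N))"
    unfolding s_def by (intro tuple_transform_append_commute dim_concat) (simp_all add: dimQ)
  ultimately have 1: "tuple_transform d (n ^ Suc N + s) (m ^ Suc N + s)
      (\<lambda>k. kron_pow (P k) (Suc N) @\<^sub>v concat_vec (map (W k) [Suc 0..<Suc N]))
      (\<lambda>k. concat_vec (map (W k) [Suc 0..<Suc N]) @\<^sub>v kron_pow (Q k) (Suc N))"
    by (rule tuple_transform_trans) (simp add: dimP dim_concat s_def del: upt_Suc kron_pow.simps)
  have l_n: "l * n = n ^ Suc N + s"
  proof -
    have "l * n = (\<Sum>j\<leftarrow>[0..<N + 1]. m ^ j * n ^ (N - j) * n)"
      unfolding l_def by (rule sum_list_mult_const [symmetric])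
    also have "\<dots> = sum_list (map w [0..<N + 1])"
      by (intro arg_cong[where f = sum_list] map_cong refl) (auto simp: w_def Suc_diff_le)
    finally show ?thesis by (simp only: upt0 s_def) (simp add: w_def)
  qed
  have l_m: "l * m = m ^ Suc N + s" and l_m': "l * m = (\<Sum>j\<leftarrow>[0..<N + 1]. w (Suc j))"
  proof -
    have "l * m = (\<Sum>j\<leftarrow>[0..<N + 1]. m ^ j * n ^ (N - j) * m)"
      unfolding l_def by (rule sum_list_mult_const [symmetric])
    also have "\<dots> = (\<Sum>j\<leftarrow>[0..<N + 1]. w (Suc j))"
      by (intro arg_cong[where f = sum_list] map_cong refl) (auto simp: w_def)
    finally show *: "l * m = (\<Sum>j\<leftarrow>[0..<N + 1]. w (Suc j))" .
    also have "\<dots> = sum_list (map w (map Suc [0..<N + 1]))"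
      by (simp only: map_map comp_def)
    finally show "l * m = m ^ Suc N + s" by (simp only: upt_snoc s_def) (simp add: w_def)
  qed
  have left: "kron_pow (P k) (Suc N) @\<^sub>v concat_vec (map (W k) [Suc 0..<Suc N])
      = concat_vec (map (V k) [0..<N + 1]) \<otimes>\<^sub>v P k" for k
  proof -
    have "concat_vec (map (V k) [0..<N + 1]) \<otimes>\<^sub>v P k = concat_vec (map (W k) [0..<N + 1])"
      unfolding kron_concat map_map comp_def
      by (intro arg_cong[where f = concat_vec] map_cong refl VP)
    then show ?thesis by (simp only: upt0) (simp add: W_def)
  qed
  have right: "concat_vec (map (W k) [Suc 0..<Suc N]) @\<^sub>v kron_pow (Q k) (Suc N)
      = concat_vec (map (\<lambda>j. Q k \<otimes>\<^sub>v V k j) [0..<N + 1])" for k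
  proof -
    have "concat_vec (map (\<lambda>j. Q k \<otimes>\<^sub>v V k j) [0..<N + 1]) = concat_vec (map (W k) (map Suc [0..<N + 1]))"
      by (simp only: VQ map_map comp_def)
    then show ?thesis by (simp only: upt_snoc map_append concat_vec_append) (simp add: W_def)
  qed
  \<comment> \<open>The shift of indices is an equality only with \<open>Q k\<close> on the left,
    whereas the catalytic output has it on the right; the factors are swapped block by
    block.\<close>
  have "tuple_transform d (l * m) (l * m)
      (\<lambda>k. concat_vec (map (\<lambda>j. Q k \<otimes>\<^sub>v V k j) [0..<N + 1]))
      (\<lambda>k. concat_vec (map (\<lambda>j. V k j \<otimes>\<^sub>v Q k) [0..<N + 1]))"
    unfolding l_m'
  proof (rule tuple_transform_concat)
    fix j
    show "tuple_transform d (w (Suc j)) (w (Suc j)) (\<lambda>k. Q k \<otimes>\<^sub>v V k j) (\<lambda>k. V k j \<otimes>\<^sub>v Q k)"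
      using tuple_transform_kron_commute[of d Q m "\<lambda>k. V k j" "m ^ j * n ^ (N - j)"]
      by (simp add: w_def V_def dimP dimQ mult_ac)
  qed (simp add: VQ dimW)
  with 1 have 2: "tuple_transform d (l * n) (l * m)
      (\<lambda>k. concat_vec (map (V k) [0..<N + 1]) \<otimes>\<^sub>v P k)
      (\<lambda>k. concat_vec (map (\<lambda>j. V k j \<otimes>\<^sub>v Q k) [0..<N + 1]))"
    unfolding left right l_n l_m
  proof (rule tuple_transform_trans)
    fix k assume "k < d"
    then show "dim_vec (concat_vec (map (V k) [0..<N + 1]) \<otimes>\<^sub>v P k) = n ^ Suc N + s"
      unfolding left [symmetric]
      by (simp add: dimP dim_concat s_def del: upt_Suc kron_pow.simps)
  qed
  have VQ': "concat_vec (map (\<lambda>j. V k j \<otimes>\<^sub>v Q k) [0..<N + 1]) = concat_vec (map (V k) [0..<N + 1]) \<otimes>\<^sub>v Q k" for k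
    by (simp only: kron_concat map_map comp_def)
  have "tuple_transform d (l * n) (l * m)
      (\<lambda>k. standard_catalyst (P k) (Q k) N \<otimes>\<^sub>v P k) (\<lambda>k. standard_catalyst (P k) (Q k) N \<otimes>\<^sub>v Q k)"
    unfolding standard_catalyst_def kron_smult_left
    unfolding V_def [symmetric]
  proof (rule tuple_transform_smult)
    show "tuple_transform d (l * n) (l * m)
      (\<lambda>k. concat_vec (map (V k) [0..<N + 1]) \<otimes>\<^sub>v P k)
      (\<lambda>k. concat_vec (map (V k) [0..<N + 1]) \<otimes>\<^sub>v Q k)"
      using 2 unfolding VQ' .
    fix k assume "k < d"
    then show "dim_vec (concat_vec (map (V k) [0..<N + 1]) \<otimes>\<^sub>v P k) = l * n"
      unfolding left [symmetric] l_n
      by (simp add: dimP dim_concat s_def del: upt_Suc kron_pow.simps)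
  qed
  then show ?thesis
    unfolding is_catalyst_def prob_tuple_def l_def [symmetric]
    using prob_vec_standard_catalyst[of n _ m _ N] P Q
      common_supp_standard_catalyst[OF supp, of n Q N] dimP
    by (auto simp: prob_tuple_def l_def)
qed

section \<open>Words and type classes\<close>

text \<open>These are the indices of an N-fold Kronecker power. With lists over an arbitrary
  alphabet, restricting to a common support just means shrinking the alphabet.\<close>

definition words :: "'a set \<Rightarrow> nat \<Rightarrow> 'a list set" where
  "words A N = {xs. set xs \<subseteq> A \<and> length xs = N}"

lemma words_0 [simp]: "words A 0 = {[]}"
  by (auto simp: words_def)

lemma finite_words [simp]: "finite A \<Longrightarrow> finite (words A N)"
  unfolding words_def by (rule finite_lists_length_eq)

lemma bij_betw_words_Suc: "bij_betw (\<lambda>(x, xs). x # xs) (A \<times> words A N) (words A (Suc N))"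
  by (rule bij_betw_byWitness[where f' = "\<lambda>xs. (hd xs, tl xs)"])
    (auto simp: words_def length_Suc_conv)

lemma sum_words_Suc:
  "(\<Sum>xs\<in>words A (Suc N). f xs) = (\<Sum>x\<in>A. \<Sum>xs\<in>words A N. f (x # xs))"
  using sum.reindex_bij_betw[OF bij_betw_words_Suc, of f A N]
  by (simp add: sum.cartesian_product case_prod_unfold)

text \<open>Expansion of the N-th power of a sum. It gives both the total mass of a product
  distribution and the multiplicativity of the partition function.\<close>

lemma sum_words_prod_list:
  fixes t :: "'a \<Rightarrow> 'b::comm_semiring_1"
  shows "(\<Sum>xs\<in>words A N. prod_list (map t xs)) = (\<Sum>x\<in>A. t x) ^ N"
  by (induction N) (simp_all add: sum_words_Suc flip: sum_distrib_left sum_distrib_right)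

section \<open>Moments of sums of independent letters\<close>

lemma sum_words_mean:
  fixes t g :: "'a \<Rightarrow> real"
  assumes "(\<Sum>x\<in>A. t x) = 1" and "(\<Sum>x\<in>A. t x * g x) = 0"
  shows "(\<Sum>xs\<in>words A N. prod_list (map t xs) * sum_list (map g xs)) = 0"
proof (induction N)
  case (Suc N)
  have "(\<Sum>xs\<in>words A (Suc N). prod_list (map t xs) * sum_list (map g xs))
      = (\<Sum>x\<in>A. \<Sum>xs\<in>words A N. t x * g x * prod_list (map t xs)
          + t x * (prod_list (map t xs) * sum_list (map g xs)))"
    by (simp add: sum_words_Suc algebra_simps)
  also have "\<dots> = 0"
    using assms Suc
    by (simp add: sum.distrib flip: sum_distrib_left sum_distrib_right)
  finally show ?case .
qed simp

text \<open>Under the product weights the first letter is independent of the rest, and the cross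
  term vanishes because the centred sum over the rest has mean 0. So variances add.\<close>

lemma sum_words_variance:
  fixes t g :: "'a \<Rightarrow> real"
  assumes t: "(\<Sum>x\<in>A. t x) = 1" and g: "(\<Sum>x\<in>A. t x * g x) = 0"
  shows "(\<Sum>xs\<in>words A N. prod_list (map t xs) * (sum_list (map g xs))\<^sup>2)
    = real N * (\<Sum>x\<in>A. t x * (g x)\<^sup>2)"
proof (induction N)
  case (Suc N)
  let ?W = "\<lambda>xs. prod_list (map t xs)" and ?G = "\<lambda>xs. sum_list (map g xs)"
  have "(\<Sum>xs\<in>words A (Suc N). ?W xs * (?G xs)\<^sup>2)
      = (\<Sum>x\<in>A. \<Sum>xs\<in>words A N. t x * (g x)\<^sup>2 * ?W xs
          + 2 * (t x * g x) * (?W xs * ?G xs) + t x * (?W xs * (?G xs)\<^sup>2))"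
    by (simp add: sum_words_Suc algebra_simps power2_eq_square)
  also have "\<dots> = (\<Sum>x\<in>A. t x * (g x)\<^sup>2 * (\<Sum>xs\<in>words A N. ?W xs)
      + 2 * (t x * g x) * (\<Sum>xs\<in>words A N. ?W xs * ?G xs)
      + t x * (\<Sum>xs\<in>words A N. ?W xs * (?G xs)\<^sup>2))"
    by (simp add: sum.distrib sum_distrib_left)
  also have "\<dots> = (\<Sum>x\<in>A. t x * (g x)\<^sup>2 + t x * (real N * (\<Sum>x\<in>A. t x * (g x)\<^sup>2)))"
    using sum_words_prod_list[of t A N] sum_words_mean[OF t g] Suc t by simp
  also have "\<dots> = real (Suc N) * (\<Sum>x\<in>A. t x * (g x)\<^sup>2)"
    using t by (simp add: sum.distrib algebra_simps flip: sum_distrib_left sum_distrib_right)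
  finally show ?case .
qed simp

text \<open>Chebyshev's inequality for N independent letters: the variance of the sum is at most
  \<open>N * K\<^sup>2\<close>, to be divided by the square of \<open>\<delta> * N\<close>.\<close>

lemma words_chebyshev:
  fixes t g :: "'a \<Rightarrow> real" and \<delta> :: real
  assumes "finite A" and t0: "\<And>x. x \<in> A \<Longrightarrow> 0 \<le> t x" and t1: "(\<Sum>x\<in>A. t x) = 1"
    and K: "\<And>x. x \<in> A \<Longrightarrow> \<bar>g x\<bar> \<le> K" and "0 < N" and "0 < \<delta>"
  defines "\<mu> \<equiv> \<Sum>x\<in>A. t x * g x"
  shows "(\<Sum>xs | xs \<in> words A N \<and> \<not> \<bar>sum_list (map g xs) - real N * \<mu>\<bar> \<le> \<delta> * N.
      prod_list (map t xs)) \<le> K\<^sup>2 / (\<delta>\<^sup>2 * N)"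
proof -
  define h where "h x = g x - \<mu>" for x
  let ?B = "{xs. xs \<in> words A N \<and> \<not> \<bar>sum_list (map g xs) - real N * \<mu>\<bar> \<le> \<delta> * N}"
  let ?W = "\<lambda>xs. prod_list (map t xs)"
  have W0: "0 \<le> ?W xs" if "xs \<in> words A N" for xs
    using that t0 by (auto simp: words_def subset_iff intro!: prod_list_nonneg)
  have th: "(\<Sum>x\<in>A. t x * h x) = 0"
    using t1 by (simp add: h_def \<mu>_def algebra_simps sum_subtractf flip: sum_distrib_left sum_distrib_right)
  have sum_h: "sum_list (map h xs) = sum_list (map g xs) - real N * \<mu>" if "xs \<in> words A N" for xs
  proof -
    have "sum_list (map h xs) = sum_list (map g xs) - real (length xs) * \<mu>"
      by (induction xs) (auto simp: h_def algebra_simps)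
    then show ?thesis using that by (simp add: words_def)
  qed
  have "(\<Sum>x\<in>A. t x * (h x)\<^sup>2) = (\<Sum>x\<in>A. t x * (g x)\<^sup>2) - \<mu>\<^sup>2"
  proof -
    \<comment> \<open>Here \<open>h\<^sup>2 = g\<^sup>2 - \<mu> * g - \<mu> * h\<close>, and the
      last term has mean 0.\<close>
    have "(\<Sum>x\<in>A. t x * (h x)\<^sup>2) = (\<Sum>x\<in>A. t x * (g x)\<^sup>2 - \<mu> * (t x * g x) - \<mu> * (t x * h x))"
      by (rule sum.cong) (auto simp: h_def algebra_simps power2_eq_square)
    also have "\<dots> = (\<Sum>x\<in>A. t x * (g x)\<^sup>2) - \<mu> * \<mu> - \<mu> * 0"
      unfolding th[symmetric] \<mu>_def by (simp only: sum_subtractf sum_distrib_left)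
    finally show ?thesis by (simp add: power2_eq_square)
  qed
  also have "\<dots> \<le> (\<Sum>x\<in>A. t x * (g x)\<^sup>2)" by simp
  also have "\<dots> \<le> (\<Sum>x\<in>A. t x * K\<^sup>2)"
    using t0 K by (intro sum_mono mult_left_mono) (auto simp: abs_le_square_iff intro: power2_le_iff_abs_le[THEN iffD2] order_trans[OF abs_ge_zero])
  also have "\<dots> = K\<^sup>2" using t1 by (simp flip: sum_distrib_right)
  finally have var: "(\<Sum>x\<in>A. t x * (h x)\<^sup>2) \<le> K\<^sup>2" .
  have "(\<delta> * N)\<^sup>2 * (\<Sum>xs\<in>?B. ?W xs) = (\<Sum>xs\<in>?B. ?W xs * (\<delta> * N)\<^sup>2)"
    by (simp add: sum_distrib_left mult.commute)
  also have "\<dots> \<le> (\<Sum>xs\<in>?B. ?W xs * (sum_list (map h xs))\<^sup>2)"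
  proof (intro sum_mono mult_left_mono)
    fix xs assume xs: "xs \<in> ?B"
    then have "\<bar>\<delta> * N\<bar> \<le> \<bar>sum_list (map h xs)\<bar>" using sum_h \<open>0 < \<delta>\<close> by auto
    then show "(\<delta> * N)\<^sup>2 \<le> (sum_list (map h xs))\<^sup>2" by (simp add: abs_le_square_iff)
  qed (use W0 in auto)
  also have "\<dots> \<le> (\<Sum>xs\<in>words A N. ?W xs * (sum_list (map h xs))\<^sup>2)"
    using W0 \<open>finite A\<close> by (intro sum_mono2) auto
  also have "\<dots> \<le> N * K\<^sup>2"
    unfolding sum_words_variance[OF t1 th] using var by (intro mult_left_mono) auto
  finally have "(\<delta> * N)\<^sup>2 * (\<Sum>xs\<in>?B. ?W xs) \<le> N * K\<^sup>2" .
  then have "N * (\<delta>\<^sup>2 * N * (\<Sum>xs\<in>?B. ?W xs)) \<le> N * K\<^sup>2"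
    by (simp add: power2_eq_square mult_ac)
  then have "\<delta>\<^sup>2 * N * (\<Sum>xs\<in>?B. ?W xs) \<le> K\<^sup>2" using \<open>0 < N\<close> by simp
  then show ?thesis using \<open>0 < N\<close> \<open>0 < \<delta>\<close> by (simp add: pos_le_divide_eq mult_ac)
qed

text \<open>The probability of a word under a product distribution depends only on its letter
  counts, that is, on its type.\<close>

lemma prod_list_map_count:
  fixes g :: "'a \<Rightarrow> 'b::comm_monoid_mult"
  assumes "finite A" and "set xs \<subseteq> A"
  shows "prod_list (map g xs) = (\<Prod>a\<in>A. g a ^ count_list xs a)"
  using assms(2)
proof (induction xs)
  case (Cons x xs)
  have "(\<Prod>a\<in>A. g a ^ count_list (x # xs) a)
      = (\<Prod>a\<in>A. (if a = x then g a else 1) * g a ^ count_list xs a)"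
    by (rule prod.cong) auto
  also have "\<dots> = g x * (\<Prod>a\<in>A. g a ^ count_list xs a)"
    using Cons.prems assms(1) by (simp add: prod.distrib)
  finally show ?case using Cons by simp
qed simp

text \<open>Each nonempty fibre contributes 1. With the type of a word as \<open>f\<close>, weights
  inverse to the size of the type class add up to the number of types.\<close>

lemma sum_inverse_fibre_card:
  assumes "finite W"
  shows "(\<Sum>x\<in>W. 1 / real (card {x' \<in> W. f x' = f x})) = real (card (f ` W))"
proof -
  have "(\<Sum>x\<in>W. 1 / real (card {x' \<in> W. f x' = f x}))
      = (\<Sum>y\<in>f ` W. \<Sum>x\<in>{x \<in> W. f x = y}. 1 / real (card {x' \<in> W. f x' = f x}))"
    by (rule sum.image_gen[OF assms])
  also have "\<dots> = (\<Sum>y\<in>f ` W. 1)"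
  proof (rule sum.cong[OF refl])
    fix y assume "y \<in> f ` W"
    then have "0 < card {x \<in> W. f x = y}" using assms by (auto simp: card_gt_0_iff)
    then show "(\<Sum>x\<in>{x \<in> W. f x = y}. 1 / real (card {x' \<in> W. f x' = f x})) = 1"
      by simp
  qed
  finally show ?thesis by simp
qed

text \<open>Each count lies between 0 and N. Restricting the counting function to \<open>A\<close>
  places the types in a finite extensional function space.\<close>

lemma card_types_le:
  assumes "finite A"
  shows "card ((\<lambda>xs. restrict (count_list xs) A) ` words A N) \<le> (N + 1) ^ card A"
proof -
  have "(\<lambda>xs. restrict (count_list xs) A) ` words A N \<subseteq> PiE A (\<lambda>_. {..N})"
    using count_le_length by (fastforce simp: words_def)
  then have "card ((\<lambda>xs. restrict (count_list xs) A) ` words A N) \<le> card (PiE A (\<lambda>_. {..N}))"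
    using assms by (intro card_mono finite_PiE) auto
  then show ?thesis using assms by (simp add: card_PiE)
qed

section \<open>The overlap of powers\<close>

text \<open>The exponents are total functions forced to vanish off \<open>C\<close>, so the simplex
  sits compactly in the full product space.\<close>

definition simplex_on :: "'k set \<Rightarrow> ('k \<Rightarrow> real) set" where
  "simplex_on C = {\<alpha>. (\<forall>k. 0 \<le> \<alpha> k) \<and> (\<forall>k. k \<notin> C \<longrightarrow> \<alpha> k = 0) \<and> (\<Sum>k\<in>C. \<alpha> k) = 1}"

text \<open>By Tychonoff's theorem a product of compact intervals is compact, with the coordinates
  off \<open>C\<close> pinned to 0; the normalisation cuts out a closed subset.\<close>

lemma compact_simplex_on:
  assumes "finite C"
  shows "compact (simplex_on C)"
proof -
  have "compactin (product_topology (\<lambda>_. euclidean) UNIV)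
      (PiE UNIV (\<lambda>k. if k \<in> C then {0..1::real} else {0}))"
    by (subst compactin_PiE) auto
  then have "compact (PiE UNIV (\<lambda>k. if k \<in> C then {0..1::real} else {0}))"
    by (simp add: euclidean_product_topology)
  moreover have "closed {\<alpha>::'a \<Rightarrow> real. (\<Sum>k\<in>C. \<alpha> k) = 1}"
    by (intro closed_Collect_eq continuous_intros continuous_on_product_coordinates)
  moreover have "simplex_on C
      = PiE UNIV (\<lambda>k. if k \<in> C then {0..1::real} else {0}) \<inter> {\<alpha>. (\<Sum>k\<in>C. \<alpha> k) = 1}"
  proof (intro equalityI subsetI)
    fix \<alpha> assume \<alpha>: "\<alpha> \<in> simplex_on C"
    have "\<alpha> k \<le> 1" if "k \<in> C" for k
      using \<alpha> that member_le_sum[OF that, of \<alpha>] assms by (auto simp: simplex_on_def)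
    then show "\<alpha> \<in> PiE UNIV (\<lambda>k. if k \<in> C then {0..1::real} else {0}) \<inter> {\<alpha>. (\<Sum>k\<in>C. \<alpha> k) = 1}"
      using \<alpha> by (auto simp: simplex_on_def)
  next
    fix \<alpha> assume "\<alpha> \<in> PiE UNIV (\<lambda>k. if k \<in> C then {0..1::real} else {0}) \<inter> {\<alpha>. (\<Sum>k\<in>C. \<alpha> k) = 1}"
    then show "\<alpha> \<in> simplex_on C"
      by (auto simp: simplex_on_def PiE_iff) (metis atLeastAtMost_iff order.refl singletonD)+
  qed
  ultimately show ?thesis by (metis compact_Int_closed)
qed

lemma vertex_in_simplex_on:
  "finite C \<Longrightarrow> k \<in> C \<Longrightarrow> (\<lambda>c. if c = k then 1 else 0) \<in> simplex_on C"
  by (simp add: simplex_on_def)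

lemma simplex_on_segment:
  assumes "\<alpha> \<in> simplex_on C" and "\<beta> \<in> simplex_on C" and "0 \<le> s" and "s \<le> 1"
  shows "(\<lambda>c. \<alpha> c + s * (\<beta> c - \<alpha> c)) \<in> simplex_on C"
proof -
  have "\<alpha> c + s * (\<beta> c - \<alpha> c) = (1 - s) * \<alpha> c + s * \<beta> c" for c by (simp add: algebra_simps)
  moreover have "0 \<le> (1 - s) * \<alpha> c + s * \<beta> c" for c
    using assms by (auto simp: simplex_on_def)
  moreover have "(\<Sum>c\<in>C. (1 - s) * \<alpha> c + s * \<beta> c) = 1"
    using assms by (simp add: simplex_on_def sum.distrib flip: sum_distrib_left)
  ultimately show ?thesis using assms by (simp add: simplex_on_def)
qed

section \<open>The partition function and exponential tilting\<close>

lemma continuous_on_partition_function: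
  "continuous_on S (\<lambda>\<alpha>. \<Sum>j\<in>B. exp (\<Sum>c\<in>C. \<alpha> c * l c j :: real))"
  by (intro continuous_intros continuous_on_subset[OF continuous_on_product_coordinates subset_UNIV])

text \<open>First-order optimality of a minimiser of the partition function along the segments to the vertices.\<close>
lemma partition_function_minimiser:
  fixes l :: "'k \<Rightarrow> 'b \<Rightarrow> real"
  assumes "finite B" and "finite C" and "C \<noteq> {}"
  shows "\<exists>\<alpha>\<in>simplex_on C. \<forall>k\<in>C.
    (\<Sum>j\<in>B. exp (\<Sum>c\<in>C. \<alpha> c * l c j) * (\<Sum>c\<in>C. \<alpha> c * l c j))
      \<le> (\<Sum>j\<in>B. exp (\<Sum>c\<in>C. \<alpha> c * l c j) * l k j)"
proof -
  define F where "F \<alpha> = (\<Sum>j\<in>B. exp (\<Sum>c\<in>C. \<alpha> c * l c j))" for \<alpha>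
  obtain k0 where "k0 \<in> C" using \<open>C \<noteq> {}\<close> by auto
  have ne: "simplex_on C \<noteq> {}"
    using vertex_in_simplex_on[OF \<open>finite C\<close> \<open>k0 \<in> C\<close>] by auto
  obtain \<alpha> where \<alpha>: "\<alpha> \<in> simplex_on C" and min: "\<And>\<beta>. \<beta> \<in> simplex_on C \<Longrightarrow> F \<alpha> \<le> F \<beta>"
    using continuous_attains_inf[OF compact_simplex_on[OF \<open>finite C\<close>] ne
        continuous_on_partition_function[of "simplex_on C" l C B]]
    unfolding F_def[symmetric] by metis
  have "(\<Sum>j\<in>B. exp (\<Sum>c\<in>C. \<alpha> c * l c j) * (\<Sum>c\<in>C. \<alpha> c * l c j))
      \<le> (\<Sum>j\<in>B. exp (\<Sum>c\<in>C. \<alpha> c * l c j) * l k j)" if k: "k \<in> C" for k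
  proof -
    define \<beta> where "\<beta> c = (if c = k then 1 else 0 :: real)" for c
    have \<beta>: "\<beta> \<in> simplex_on C"
      unfolding \<beta>_def using vertex_in_simplex_on[OF \<open>finite C\<close> k] .
    define D where "D j = (\<Sum>c\<in>C. (\<beta> c - \<alpha> c) * l c j)" for j
    define a where "a j = (\<Sum>c\<in>C. \<alpha> c * l c j)" for j
    have F: "F (\<lambda>c. \<alpha> c + s * (\<beta> c - \<alpha> c)) = (\<Sum>j\<in>B. exp (a j + s * D j))" for s
      by (simp add: F_def a_def D_def algebra_simps sum.distrib sum_subtractf sum_distrib_left)
    have deriv: "((\<lambda>s. \<Sum>j\<in>B. exp (a j + s * D j)) has_real_derivative (\<Sum>j\<in>B. exp (a j) * D j)) (at 0)"
      by (auto intro!: derivative_eq_intros)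
    have "0 \<le> (\<Sum>j\<in>B. exp (a j) * D j)"
    proof (rule ccontr)
      assume "\<not> ?thesis"
      then have "(\<Sum>j\<in>B. exp (a j) * D j) < 0" by simp
      from DERIV_neg_dec_right[OF deriv this] obtain e where
        e: "e > 0" "\<And>h. h > 0 \<Longrightarrow> h < e \<Longrightarrow> (\<Sum>j\<in>B. exp (a j + h * D j)) < (\<Sum>j\<in>B. exp (a j))"
        by auto
      \<comment> \<open>\<open>h \<le> 1\<close> keeps the point on the segment and hence in the
        simplex; \<open>h < e\<close> keeps it where the negative derivative forces a value below
        the minimum.\<close>
      define h where "h = min 1 (e / 2)"
      have h: "h > 0" "h < e" "h \<le> 1" using e(1) by (auto simp: h_def min_def)
      have "F \<alpha> \<le> F (\<lambda>c. \<alpha> c + h * (\<beta> c - \<alpha> c))"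
        using h by (intro min simplex_on_segment \<alpha> \<beta>) auto
      then show False using e(2)[OF h(1,2)] unfolding F by (simp add: F_def a_def)
    qed
    moreover have "D j = l k j - a j" for j
    proof -
      have "(\<Sum>c\<in>C. \<beta> c * l c j) = (\<Sum>c\<in>C. if c = k then l c j else 0)"
        by (rule sum.cong) (auto simp: \<beta>_def)
      then have "(\<Sum>c\<in>C. \<beta> c * l c j) = l k j" using k \<open>finite C\<close> by simp
      then show ?thesis by (simp add: D_def a_def left_diff_distrib sum_subtractf)
    qed
    ultimately show ?thesis by (simp add: a_def right_diff_distrib sum_subtractf)
  qed
  then show ?thesis using \<alpha> by blast
qed

text \<open>A minimum is at most any weighted mean, so each \<alpha> yields an upper bound for the
  right-hand side of the form of a partition function to the power N. The minimising \<alpha> makes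
  this sharp up to \<open>exp (- 2 * \<delta> * N)\<close>: in the distribution tilted by it, no
  coordinate has mean excess below the \<alpha>-average, so on typical words the minimum and the
  average nearly agree.\<close>

lemma chernoff_lower_bound:
  fixes g :: "'k \<Rightarrow> 'b \<Rightarrow> real" and b :: "'k \<Rightarrow> real" and \<delta> :: real
  assumes B: "finite B" "B \<noteq> {}" and C: "finite C" "C \<noteq> {}"
    and K: "\<And>k j. k \<in> C \<Longrightarrow> j \<in> B \<Longrightarrow> \<bar>g k j\<bar> \<le> K" and "0 < N" and "0 < \<delta>"
  obtains \<alpha> where "\<alpha> \<in> simplex_on C"
    and "(1 - card C * (K\<^sup>2 / (\<delta>\<^sup>2 * N)))
        * ((\<Sum>j\<in>B. exp (\<Sum>k\<in>C. \<alpha> k * g k j)) ^ N * exp (- real N * (\<Sum>k\<in>C. \<alpha> k * b k) - 2 * \<delta> * N))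
      \<le> (\<Sum>xs\<in>words B N. exp (Min ((\<lambda>k. sum_list (map (g k) xs) - N * b k) ` C)))"
proof -
  from partition_function_minimiser[OF B(1) C, of "\<lambda>c j. g c j - b c"]
  obtain \<alpha> where \<alpha>: "\<alpha> \<in> simplex_on C"
    and opt: "\<forall>k\<in>C.
      (\<Sum>j\<in>B. exp (\<Sum>c\<in>C. \<alpha> c * (g c j - b c)) * (\<Sum>c\<in>C. \<alpha> c * (g c j - b c)))
      \<le> (\<Sum>j\<in>B. exp (\<Sum>c\<in>C. \<alpha> c * (g c j - b c)) * (g k j - b k))"
    by blast
  have \<alpha>0: "0 \<le> \<alpha> c" for c using \<alpha> by (simp add: simplex_on_def)
  have \<alpha>1: "(\<Sum>c\<in>C. \<alpha> c) = 1" using \<alpha> by (simp add: simplex_on_def)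
  define w where "w j = exp (\<Sum>c\<in>C. \<alpha> c * g c j)" for j
  define Z where "Z = (\<Sum>j\<in>B. w j)"
  define t where "t j = w j / Z" for j
  define \<mu> where "\<mu> k = (\<Sum>j\<in>B. t j * g k j)" for k
  define \<beta> where "\<beta> = (\<Sum>c\<in>C. \<alpha> c * b c)"
  define \<kappa> where "\<kappa> = (\<Sum>c\<in>C. \<alpha> c * \<mu> c) - \<beta>"
  have Z: "0 < Z" unfolding Z_def using B by (intro sum_pos) (auto simp: w_def)
  have t0: "0 \<le> t j" for j using Z by (simp add: t_def w_def)
  have t1: "(\<Sum>j\<in>B. t j) = 1" using Z by (simp add: t_def Z_def flip: sum_divide_distrib)
  \<comment> \<open>Subtracting b scales all weights by one constant, so optimality for the shifted
    exponents is a statement about the same tilted distribution \<open>t\<close>.\<close>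
  have w: "exp (\<Sum>c\<in>C. \<alpha> c * (g c j - b c)) = t j * (Z * exp (- \<beta>))" for j
    using Z by (simp add: w_def t_def \<beta>_def right_diff_distrib sum_subtractf exp_diff exp_minus field_simps)
  \<comment> \<open>The optimality condition, divided by the positive constant
    \<open>Z * exp (- \<beta>)\<close>: every mean excess is at least the \<alpha>-average
    \<kappa>.\<close>
  have \<kappa>: "\<kappa> \<le> \<mu> k - b k" if k: "k \<in> C" for k
  proof -
    have "(\<Sum>j\<in>B. t j * (Z * exp (- \<beta>)) * (\<Sum>c\<in>C. \<alpha> c * (g c j - b c)))
        = Z * exp (- \<beta>) * (\<Sum>j\<in>B. t j * (\<Sum>c\<in>C. \<alpha> c * (g c j - b c)))"
      by (simp add: sum_distrib_left mult_ac)
    also have "(\<Sum>j\<in>B. t j * (\<Sum>c\<in>C. \<alpha> c * (g c j - b c)))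
        = (\<Sum>j\<in>B. \<Sum>c\<in>C. \<alpha> c * (t j * g c j)) - (\<Sum>j\<in>B. t j * \<beta>)"
      by (simp add: right_diff_distrib sum_subtractf sum_distrib_left \<beta>_def mult_ac)
    also have "\<dots> = \<kappa>"
      unfolding \<kappa>_def \<mu>_def sum_distrib_left using t1
      by (subst sum.swap) (simp flip: sum_distrib_right)
    finally have 1: "(\<Sum>j\<in>B. t j * (Z * exp (- \<beta>)) * (\<Sum>c\<in>C. \<alpha> c * (g c j - b c))) = Z * exp (- \<beta>) * \<kappa>" .
    have "(\<Sum>j\<in>B. t j * (Z * exp (- \<beta>)) * (g k j - b k))
        = Z * exp (- \<beta>) * (\<Sum>j\<in>B. t j * g k j - t j * b k)"
      by (simp add: sum_distrib_left algebra_simps)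
    also have "(\<Sum>j\<in>B. t j * g k j - t j * b k) = \<mu> k - b k"
      using t1 by (simp add: \<mu>_def sum_subtractf flip: sum_distrib_right)
    finally have 2: "(\<Sum>j\<in>B. t j * (Z * exp (- \<beta>)) * (g k j - b k)) = Z * exp (- \<beta>) * (\<mu> k - b k)" .
    have "Z * exp (- \<beta>) * \<kappa> \<le> Z * exp (- \<beta>) * (\<mu> k - b k)"
      using bspec[OF opt k] unfolding w 1 2 .
    then show ?thesis using Z by simp
  qed
  let ?W = "\<lambda>xs. prod_list (map t xs)"
  define Bad where "Bad k xs \<longleftrightarrow> \<not> \<bar>sum_list (map (g k) xs) - real N * \<mu> k\<bar> \<le> \<delta> * N" for k xs
  define G where "G = {xs \<in> words B N. \<forall>k\<in>C. \<not> Bad k xs}"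
  have W0: "0 \<le> ?W xs" for xs using t0 by (intro prod_list_nonneg) auto
  \<comment> \<open>A union bound over the coordinates in \<open>C\<close>, with Chebyshev's
    inequality for each.\<close>
  have WG: "1 - card C * (K\<^sup>2 / (\<delta>\<^sup>2 * N)) \<le> (\<Sum>xs\<in>G. ?W xs)"
  proof -
    have "1 = (\<Sum>xs\<in>words B N. ?W xs)" using t1 by (simp add: sum_words_prod_list)
    also have "\<dots> \<le> (\<Sum>xs\<in>words B N. (if \<forall>k\<in>C. \<not> Bad k xs then ?W xs else 0)
        + (\<Sum>k\<in>C. if Bad k xs then ?W xs else 0))"
    proof (rule sum_mono)
      fix xs
      show "?W xs \<le> (if \<forall>k\<in>C. \<not> Bad k xs then ?W xs else 0) + (\<Sum>k\<in>C. if Bad k xs then ?W xs else 0)"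
      proof (cases "\<forall>k\<in>C. \<not> Bad k xs")
        case True
        then show ?thesis using W0[of xs] by (simp add: sum_nonneg)
      next
        case False
        then obtain k where k: "k \<in> C" "Bad k xs" by auto
        have "(if Bad k xs then ?W xs else 0) \<le> (\<Sum>k\<in>C. if Bad k xs then ?W xs else 0)"
          using C(1) W0 k by (intro member_le_sum) auto
        then show ?thesis using k False by simp
      qed
    qed
    also have "\<dots> = (\<Sum>xs\<in>G. ?W xs) + (\<Sum>k\<in>C. \<Sum>xs | xs \<in> words B N \<and> Bad k xs. ?W xs)"
    proof -
      have "(\<Sum>xs\<in>words B N. if \<forall>k\<in>C. \<not> Bad k xs then ?W xs else 0) = (\<Sum>xs\<in>G. ?W xs)"
        unfolding G_def using B(1) by (simp add: sum.inter_filter)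
      moreover have "(\<Sum>xs\<in>words B N. \<Sum>k\<in>C. if Bad k xs then ?W xs else 0)
          = (\<Sum>k\<in>C. \<Sum>xs | xs \<in> words B N \<and> Bad k xs. ?W xs)"
        using B(1) by (subst sum.swap) (simp add: sum.inter_filter)
      ultimately show ?thesis by (simp add: sum.distrib)
    qed
    also have "\<dots> \<le> (\<Sum>xs\<in>G. ?W xs) + (\<Sum>k\<in>C. K\<^sup>2 / (\<delta>\<^sup>2 * N))"
    proof (intro add_left_mono sum_mono)
      fix k assume "k \<in> C"
      then show "(\<Sum>xs | xs \<in> words B N \<and> Bad k xs. ?W xs) \<le> K\<^sup>2 / (\<delta>\<^sup>2 * N)"
        unfolding Bad_def \<mu>_def
        using words_chebyshev[OF B(1) t0 t1 _ \<open>0 < N\<close> \<open>0 < \<delta>\<close>, of "g k" K] K by blast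
    qed
    finally show ?thesis by simp
  qed
  \<comment> \<open>The factor \<open>Z ^ N\<close> undoes the tilting. Of the slack
    \<open>2 * \<delta> * N\<close>, one half pays for the deviation of the \<alpha>-average from
    above, the other for the deviation of the smallest coordinate from below.\<close>
  define c where "c = Z ^ N * exp (- real N * \<beta> - 2 * \<delta> * N)"
  have c0: "0 \<le> c" using Z by (simp add: c_def)
  have "?W xs * c \<le> exp (Min ((\<lambda>k. sum_list (map (g k) xs) - N * b k) ` C))" if "xs \<in> G" for xs
  proof -
    have dev: "\<bar>sum_list (map (g k) xs) - real N * \<mu> k\<bar> \<le> \<delta> * N" if "k \<in> C" for k
      using \<open>xs \<in> G\<close> that by (auto simp: G_def Bad_def)
    have "?W xs * Z ^ length xs = exp (\<Sum>k\<in>C. \<alpha> k * sum_list (map (g k) xs))"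
    proof (induction xs)
      case (Cons x xs)
      have "?W (x # xs) * Z ^ length (x # xs) = w x * (?W xs * Z ^ length xs)"
        using Z by (simp add: t_def)
      also have "\<dots> = exp (\<Sum>k\<in>C. \<alpha> k * sum_list (map (g k) (x # xs)))"
        unfolding Cons.IH by (simp add: w_def exp_add distrib_left sum.distrib)
      finally show ?case .
    qed simp
    moreover have "length xs = N" using \<open>xs \<in> G\<close> by (simp add: G_def words_def)
    ultimately have "?W xs * c = exp ((\<Sum>k\<in>C. \<alpha> k * sum_list (map (g k) xs)) - N * \<beta> - 2 * \<delta> * N)"
      by (simp add: c_def exp_diff exp_minus exp_add field_simps)
    also have "\<dots> \<le> exp (N * \<kappa> - \<delta> * N)"
    proof -
      have "(\<Sum>k\<in>C. \<alpha> k * sum_list (map (g k) xs)) \<le> (\<Sum>k\<in>C. \<alpha> k * (N * \<mu> k + \<delta> * N))"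
      proof (intro sum_mono mult_left_mono \<alpha>0)
        fix k assume "k \<in> C"
        then show "sum_list (map (g k) xs) \<le> N * \<mu> k + \<delta> * N" using dev[of k] by linarith
      qed
      also have "\<dots> = N * (\<Sum>k\<in>C. \<alpha> k * \<mu> k) + (\<Sum>k\<in>C. \<alpha> k) * (\<delta> * N)"
        by (simp add: distrib_left sum.distrib sum_distrib_left sum_distrib_right mult_ac)
      finally show ?thesis using \<alpha>1 by (simp add: \<kappa>_def algebra_simps)
    qed
    also have "\<dots> \<le> exp (Min ((\<lambda>k. sum_list (map (g k) xs) - N * b k) ` C))"
    proof -
      have "N * \<kappa> - \<delta> * N \<le> sum_list (map (g k) xs) - N * b k" if k: "k \<in> C" for k
      proof -
        have "N * \<kappa> \<le> N * (\<mu> k - b k)" using \<kappa>[OF k] by (intro mult_left_mono) auto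
        then show ?thesis using dev[OF k] by (auto simp: abs_le_iff algebra_simps)
      qed
      then show ?thesis using C by simp
    qed
    finally show ?thesis .
  qed
  then have "(\<Sum>xs\<in>G. ?W xs * c) \<le> (\<Sum>xs\<in>G. exp (Min ((\<lambda>k. sum_list (map (g k) xs) - N * b k) ` C)))"
    by (rule sum_mono)
  also have "\<dots> \<le> (\<Sum>xs\<in>words B N. exp (Min ((\<lambda>k. sum_list (map (g k) xs) - N * b k) ` C)))"
    using B(1) by (intro sum_mono2) (auto simp: G_def)
  finally have "(\<Sum>xs\<in>G. ?W xs) * c \<le> (\<Sum>xs\<in>words B N. exp (Min ((\<lambda>k. sum_list (map (g k) xs) - N * b k) ` C)))"
    by (simp add: sum_distrib_right)
  moreover have "(1 - card C * (K\<^sup>2 / (\<delta>\<^sup>2 * N))) * c \<le> (\<Sum>xs\<in>G. ?W xs) * c"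
    using WG c0 by (rule mult_right_mono)
  ultimately have "(1 - card C * (K\<^sup>2 / (\<delta>\<^sup>2 * N))) * c
      \<le> (\<Sum>xs\<in>words B N. exp (Min ((\<lambda>k. sum_list (map (g k) xs) - N * b k) ` C)))"
    by linarith
  then show ?thesis using that[OF \<alpha>] unfolding c_def Z_def w_def \<beta>_def by blast
qed

lemma eventually_power_le_exp:
  fixes \<epsilon> :: real
  assumes "0 < \<epsilon>"
  shows "\<forall>\<^sub>F N in sequentially. real (N + 1) ^ m \<le> exp (\<epsilon> * N) / 2"
proof -
  have "filterlim (\<lambda>N. \<epsilon> * real N) at_top sequentially"
    using assms by (intro filterlim_tendsto_pos_mult_at_top[OF tendsto_const] filterlim_real_sequentially)
  then have "((\<lambda>N. (\<epsilon> * real N) ^ m / exp (\<epsilon> * real N)) \<longlongrightarrow> 0) sequentially"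
    by (rule filterlim_compose[OF tendsto_power_div_exp_0])
  \<comment> \<open>The threshold cancels the factor \<open>(2 / \<epsilon>) ^ m\<close>, which
    arises from \<open>N + 1 \<le> 2 * N\<close> and from rescaling by \<epsilon>, and leaves the
    factor 1/2.\<close>
  moreover have "0 < (\<epsilon> / 2) ^ m / 2" using assms by simp
  ultimately have "\<forall>\<^sub>F N in sequentially. (\<epsilon> * real N) ^ m / exp (\<epsilon> * real N) < (\<epsilon> / 2) ^ m / 2"
    by (rule order_tendstoD)
  then show ?thesis using eventually_ge_at_top[of 1]
  proof eventually_elim
    case (elim N)
    have "real (N + 1) ^ m \<le> (2 * real N) ^ m" using elim by (intro power_mono) auto
    also have "\<dots> = (2 / \<epsilon>) ^ m * (\<epsilon> * real N) ^ m"
      unfolding power_mult_distrib [symmetric] using assms by simp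
    also have "\<dots> \<le> (2 / \<epsilon>) ^ m * ((\<epsilon> / 2) ^ m / 2 * exp (\<epsilon> * real N))"
      using elim assms by (intro mult_left_mono) (auto simp: pos_divide_less_eq)
    also have "\<dots> = ((2 / \<epsilon>) * (\<epsilon> / 2)) ^ m * (exp (\<epsilon> * N) / 2)"
      by (simp only: power_mult_distrib)
    finally show ?case using assms by simp
  qed
qed

lemma prod_powr_eq_exp:
  fixes x \<alpha> :: "'k \<Rightarrow> real"
  assumes "finite C" and "\<And>k. k \<in> C \<Longrightarrow> 0 < x k"
  shows "(\<Prod>k\<in>C. x k powr \<alpha> k) = exp (\<Sum>k\<in>C. \<alpha> k * ln (x k))"
proof -
  have "x k powr \<alpha> k = exp (\<alpha> k * ln (x k))" if "k \<in> C" for k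
    using assms(2)[OF that] by (simp add: powr_def)
  then show ?thesis using assms(1) by (simp add: exp_sum)
qed

text \<open>The ratio of the two partition functions is continuous on a compact set and below 1
  there, so its maximum is below 1; \<epsilon> is minus the logarithm of such a bound.\<close>

lemma partition_function_gap:
  assumes B: "finite B" "B \<noteq> {}" and C: "finite C" "C \<noteq> {}"
    and less: "\<And>\<alpha>. \<alpha> \<in> simplex_on C \<Longrightarrow>
      (\<Sum>i\<in>A. exp (\<Sum>k\<in>C. \<alpha> k * f k i)) < (\<Sum>j\<in>B. exp (\<Sum>k\<in>C. \<alpha> k * g k j :: real))"
  obtains \<epsilon> where "0 < \<epsilon>" and "\<And>\<alpha>. \<alpha> \<in> simplex_on C \<Longrightarrow>
      (\<Sum>i\<in>A. exp (\<Sum>k\<in>C. \<alpha> k * f k i)) \<le> exp (- \<epsilon>) * (\<Sum>j\<in>B. exp (\<Sum>k\<in>C. \<alpha> k * g k j))"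
proof -
  define X where "X \<alpha> = (\<Sum>i\<in>A. exp (\<Sum>k\<in>C. \<alpha> k * f k i))" for \<alpha>
  define Y where "Y \<alpha> = (\<Sum>j\<in>B. exp (\<Sum>k\<in>C. \<alpha> k * g k j))" for \<alpha>
  have Y: "0 < Y \<alpha>" for \<alpha> unfolding Y_def using B by (intro sum_pos) auto
  obtain k0 where "k0 \<in> C" using \<open>C \<noteq> {}\<close> by auto
  have ne: "simplex_on C \<noteq> {}"
    using vertex_in_simplex_on[OF \<open>finite C\<close> \<open>k0 \<in> C\<close>] by auto
  have "continuous_on (simplex_on C) (\<lambda>\<alpha>. X \<alpha> / Y \<alpha>)"
    unfolding X_def Y_def using Y[unfolded Y_def]
    by (intro continuous_on_divide continuous_on_partition_function) (metis less_irrefl)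
  from continuous_attains_sup[OF compact_simplex_on[OF C(1)] ne this]
  obtain \<alpha>0 where \<alpha>0: "\<alpha>0 \<in> simplex_on C"
    and max: "\<And>\<alpha>. \<alpha> \<in> simplex_on C \<Longrightarrow> X \<alpha> / Y \<alpha> \<le> X \<alpha>0 / Y \<alpha>0" by auto
  \<comment> \<open>The maximal ratio may be 0, for instance for empty \<open>A\<close>; the bound
    1/2 keeps the logarithm meaningful.\<close>
  define \<rho> where "\<rho> = max (X \<alpha>0 / Y \<alpha>0) (1 / 2)"
  have \<rho>: "0 < \<rho>" "\<rho> < 1"
    using less[OF \<alpha>0] Y[of \<alpha>0] by (auto simp: \<rho>_def X_def Y_def)
  show ?thesis
  proof (rule that[of "- ln \<rho>"])
    show "0 < - ln \<rho>" using \<rho> by simp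
    fix \<alpha> assume "\<alpha> \<in> simplex_on C"
    then have "X \<alpha> / Y \<alpha> \<le> \<rho>" using max by (auto simp: \<rho>_def le_max_iff_disj)
    then have "X \<alpha> \<le> \<rho> * Y \<alpha>" using Y[of \<alpha>] by (simp add: pos_divide_le_eq)
    then show "(\<Sum>i\<in>A. exp (\<Sum>k\<in>C. \<alpha> k * f k i)) \<le> exp (- (- ln \<rho>)) * (\<Sum>j\<in>B. exp (\<Sum>k\<in>C. \<alpha> k * g k j))"
      using \<rho> by (simp add: X_def Y_def)
  qed
qed

text \<open>The quantifier over a stands inside \<open>eventually\<close> because a will hold the
  masses of a type class, which vary with N and with the class. Uniformity holds since the gap
  \<epsilon> and the bound \<open>K\<close> on the logarithms do not depend on a.\<close>

lemma eventually_overlap_ge: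
  fixes p :: "'k \<Rightarrow> 'a \<Rightarrow> real" and q :: "'k \<Rightarrow> 'b \<Rightarrow> real"
  assumes B: "finite B" "B \<noteq> {}" and C: "finite C" "C \<noteq> {}"
    and p: "\<And>k i. k \<in> C \<Longrightarrow> i \<in> A \<Longrightarrow> 0 < p k i" and q: "\<And>k j. k \<in> C \<Longrightarrow> j \<in> B \<Longrightarrow> 0 < q k j"
    and less: "\<And>\<alpha>. \<alpha> \<in> simplex_on C \<Longrightarrow>
      (\<Sum>i\<in>A. \<Prod>k\<in>C. p k i powr \<alpha> k) < (\<Sum>j\<in>B. \<Prod>k\<in>C. q k j powr \<alpha> k)"
  shows "\<forall>\<^sub>F N in sequentially. \<forall>a. (\<forall>k\<in>C. 0 < a k) \<longrightarrow>
      (\<forall>\<alpha>\<in>simplex_on C. (\<Prod>k\<in>C. a k powr \<alpha> k) \<le> (\<Sum>i\<in>A. \<Prod>k\<in>C. p k i powr \<alpha> k) ^ N) \<longrightarrow>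
      real (N + 1) ^ m \<le> (\<Sum>ys\<in>words B N. Min ((\<lambda>k. prod_list (map (q k) ys) / a k) ` C))"
proof -
  define X where "X \<alpha> = (\<Sum>i\<in>A. \<Prod>k\<in>C. p k i powr \<alpha> k)" for \<alpha>
  define Y where "Y \<alpha> = (\<Sum>j\<in>B. \<Prod>k\<in>C. q k j powr \<alpha> k)" for \<alpha>
  have X: "X \<alpha> = (\<Sum>i\<in>A. exp (\<Sum>k\<in>C. \<alpha> k * ln (p k i)))" for \<alpha>
    unfolding X_def using p C(1) by (intro sum.cong refl prod_powr_eq_exp) auto
  have Y: "Y \<alpha> = (\<Sum>j\<in>B. exp (\<Sum>k\<in>C. \<alpha> k * ln (q k j)))" for \<alpha>
    unfolding Y_def using q C(1) by (intro sum.cong refl prod_powr_eq_exp) auto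
  have "\<And>\<alpha>. \<alpha> \<in> simplex_on C \<Longrightarrow> X \<alpha> < Y \<alpha>" using less by (simp add: X_def Y_def)
  from partition_function_gap[OF B C this[unfolded X Y]]
  obtain \<epsilon> where \<epsilon>: "0 < \<epsilon>" and gap: "\<And>\<alpha>. \<alpha> \<in> simplex_on C \<Longrightarrow> X \<alpha> \<le> exp (- \<epsilon>) * Y \<alpha>"
    unfolding X Y by blast
  have X0: "0 \<le> X \<alpha>" for \<alpha> unfolding X by (intro sum_nonneg) auto
  obtain K where K: "\<And>k j. k \<in> C \<Longrightarrow> j \<in> B \<Longrightarrow> \<bar>ln (q k j)\<bar> \<le> K"
  proof
    fix k j assume "k \<in> C" "j \<in> B"
    then show "\<bar>ln (q k j)\<bar> \<le> Max ((\<lambda>(k, j). \<bar>ln (q k j)\<bar>) ` (C \<times> B))"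
      using B C by (intro Max_ge) auto
  qed
  \<comment> \<open>Of the gap \<open>exp (\<epsilon> * N)\<close>, the slack
    \<open>2 * \<delta> * N\<close> uses up half of the exponent. The typical words eventually carry
    tilted mass at least 1/2, and \<open>exp (\<epsilon> / 2 * N) / 2\<close> still exceeds the
    polynomial.\<close>
  define \<delta> where "\<delta> = \<epsilon> / 4"
  have \<delta>: "0 < \<delta>" using \<epsilon> by (simp add: \<delta>_def)
  have "((\<lambda>N. card C * K\<^sup>2 / \<delta>\<^sup>2 / real N) \<longlongrightarrow> 0) sequentially"
    by (rule tendsto_divide_0[OF tendsto_const filterlim_at_top_imp_at_infinity[OF filterlim_real_sequentially]])
  then have "\<forall>\<^sub>F N in sequentially. card C * K\<^sup>2 / \<delta>\<^sup>2 / real N < 1 / 2"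
    by (rule order_tendstoD) simp
  moreover have "\<forall>\<^sub>F N in sequentially. real (N + 1) ^ m \<le> exp (\<epsilon> / 2 * N) / 2"
    using \<epsilon> by (intro eventually_power_le_exp) simp
  ultimately show ?thesis
    using eventually_gt_at_top[of 0]
  proof eventually_elim
    case (elim N)
    show ?case
    proof (intro allI impI)
      fix a assume a: "\<forall>k\<in>C. 0 < a k"
        and aX: "\<forall>\<alpha>\<in>simplex_on C. (\<Prod>k\<in>C. a k powr \<alpha> k) \<le> (\<Sum>i\<in>A. \<Prod>k\<in>C. p k i powr \<alpha> k) ^ N"
      \<comment> \<open>Chosen so that \<open>exp (N * b k) = a k\<close>; subtracting
        \<open>N * b k\<close> in the exponent is then division by \<open>a k\<close>.\<close>
      define b where "b k = ln (a k) / N" for k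
      obtain \<alpha> where \<alpha>: "\<alpha> \<in> simplex_on C"
        and ch: "(1 - card C * (K\<^sup>2 / (\<delta>\<^sup>2 * N)))
            * ((\<Sum>j\<in>B. exp (\<Sum>k\<in>C. \<alpha> k * ln (q k j))) ^ N * exp (- real N * (\<Sum>k\<in>C. \<alpha> k * b k) - 2 * \<delta> * N))
          \<le> (\<Sum>xs\<in>words B N. exp (Min ((\<lambda>k. sum_list (map (\<lambda>j. ln (q k j)) xs) - N * b k) ` C)))"
        by (rule chernoff_lower_bound[OF B C, of "\<lambda>k j. ln (q k j)" K N \<delta> b])
          (use K elim \<delta> in auto)
      have Nb: "N * (\<Sum>k\<in>C. \<alpha> k * b k) = (\<Sum>k\<in>C. \<alpha> k * ln (a k))"
        using elim by (simp add: b_def sum_distrib_left)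
      have "exp (\<Sum>k\<in>C. \<alpha> k * ln (a k)) = (\<Prod>k\<in>C. a k powr \<alpha> k)"
        using a C by (intro prod_powr_eq_exp[symmetric]) auto
      also have "\<dots> \<le> X \<alpha> ^ N" using aX \<alpha> by (simp add: X_def)
      also have "\<dots> \<le> (exp (- \<epsilon>) * Y \<alpha>) ^ N" using gap[OF \<alpha>] X0 by (intro power_mono) auto
      also have "\<dots> = exp (- (\<epsilon> * N)) * Y \<alpha> ^ N"
        by (simp add: power_mult_distrib mult.commute flip: exp_of_nat_mult)
      finally have le: "exp (\<epsilon> * N) * exp (\<Sum>k\<in>C. \<alpha> k * ln (a k)) \<le> Y \<alpha> ^ N"
        by (simp add: exp_minus field_simps)
      have "real (N + 1) ^ m \<le> 1 / 2 * exp (\<epsilon> / 2 * N)" using elim by simp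
      also have "\<dots> \<le> (1 - card C * (K\<^sup>2 / (\<delta>\<^sup>2 * N)))
          * (Y \<alpha> ^ N * exp (- (\<Sum>k\<in>C. \<alpha> k * ln (a k)) - 2 * \<delta> * N))"
      proof (rule mult_mono)
        show "1 / 2 \<le> 1 - card C * (K\<^sup>2 / (\<delta>\<^sup>2 * N))" using elim by simp
        then show "0 \<le> 1 - card C * (K\<^sup>2 / (\<delta>\<^sup>2 * N))" by linarith
        have "exp (\<epsilon> / 2 * N) = exp (\<epsilon> * N) * exp (\<Sum>k\<in>C. \<alpha> k * ln (a k))
            * exp (- (\<Sum>k\<in>C. \<alpha> k * ln (a k)) - 2 * \<delta> * N)"
          by (simp add: \<delta>_def flip: exp_add)
        also have "\<dots> \<le> Y \<alpha> ^ N * exp (- (\<Sum>k\<in>C. \<alpha> k * ln (a k)) - 2 * \<delta> * N)"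
          by (rule mult_right_mono[OF le]) simp
        finally show "exp (\<epsilon> / 2 * N) \<le> Y \<alpha> ^ N * exp (- (\<Sum>k\<in>C. \<alpha> k * ln (a k)) - 2 * \<delta> * N)" .
      qed simp
      also have "\<dots> \<le> (\<Sum>xs\<in>words B N. exp (Min ((\<lambda>k. sum_list (map (\<lambda>j. ln (q k j)) xs) - N * b k) ` C)))"
        using ch Nb by (simp add: Y)
      also have "\<dots> = (\<Sum>ys\<in>words B N. Min ((\<lambda>k. prod_list (map (q k) ys) / a k) ` C))"
      proof (rule sum.cong[OF refl])
        fix ys assume ys: "ys \<in> words B N"
        have "exp (sum_list (map (\<lambda>j. ln (q k j)) ys) - N * b k) = prod_list (map (q k) ys) / a k"
          if k: "k \<in> C" for k
        proof -
          have "set ys \<subseteq> B" using ys by (simp add: words_def)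
          then have "exp (sum_list (map (\<lambda>j. ln (q k j)) ys)) = prod_list (map (q k) ys)"
            by (induction ys) (use q k in \<open>auto simp: exp_add\<close>)
          then show ?thesis using elim a k by (simp add: b_def exp_diff)
        qed
        then have "exp ` (\<lambda>k. sum_list (map (\<lambda>j. ln (q k j)) ys) - N * b k) ` C
            = (\<lambda>k. prod_list (map (q k) ys) / a k) ` C"
          unfolding image_image by (rule image_cong[OF refl])
        then show "exp (Min ((\<lambda>k. sum_list (map (\<lambda>j. ln (q k j)) ys) - N * b k) ` C))
            = Min ((\<lambda>k. prod_list (map (q k) ys) / a k) ` C)"
          using mono_Min_commute[of "exp :: real \<Rightarrow> real"] C by (simp add: mono_def)
      qed
      finally show "real (N + 1) ^ m \<le> (\<Sum>ys\<in>words B N. Min ((\<lambda>k. prod_list (map (q k) ys) / a k) ` C))" .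
    qed
  qed
qed

section \<open>Monotonicity\<close>

text \<open>The graph of exp lies above its tangent at \<open>m\<close>, the weighted mean of the
  logarithms; on averaging, the linear terms cancel.\<close>

lemma weighted_arith_geom_mean:
  fixes z \<alpha> :: "'k \<Rightarrow> real"
  assumes D: "finite D" and \<alpha>: "\<And>k. k \<in> D \<Longrightarrow> 0 \<le> \<alpha> k" "(\<Sum>k\<in>D. \<alpha> k) = 1"
    and z: "\<And>k. k \<in> D \<Longrightarrow> 0 < z k"
  shows "(\<Prod>k\<in>D. z k powr \<alpha> k) \<le> (\<Sum>k\<in>D. \<alpha> k * z k)"
proof -
  define m where "m = (\<Sum>k\<in>D. \<alpha> k * ln (z k))"
  have "(\<Prod>k\<in>D. z k powr \<alpha> k) = exp m"
    unfolding m_def using D z by (rule prod_powr_eq_exp)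
  also have "\<dots> = exp m * ((\<Sum>k\<in>D. \<alpha> k) + (\<Sum>k\<in>D. \<alpha> k * ln (z k)) - (\<Sum>k\<in>D. \<alpha> k) * m)"
    unfolding \<alpha>(2) m_def[symmetric] by simp
  also have "\<dots> = (\<Sum>k\<in>D. \<alpha> k * (exp m * (1 + (ln (z k) - m))))"
    by (simp add: sum_distrib_left sum_distrib_right algebra_simps sum.distrib sum_subtractf)
  also have "\<dots> \<le> (\<Sum>k\<in>D. \<alpha> k * z k)"
  proof (intro sum_mono mult_left_mono \<alpha>(1))
    fix k assume k: "k \<in> D"
    have "exp m * (1 + (ln (z k) - m)) \<le> exp m * exp (ln (z k) - m)"
      by (intro mult_left_mono exp_ge_add_one_self) simp
    also have "\<dots> = z k" using z[OF k] by (simp flip: exp_add)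
    finally show "exp m * (1 + (ln (z k) - m)) \<le> z k" .
  qed
  finally show ?thesis .
qed

lemma Phi_eq:
  assumes "C \<noteq> {}" and "\<And>c. c \<in> C \<Longrightarrow> dim_vec (P c) = n"
  shows "Phi \<alpha> C P = (\<Sum>i | i < n \<and> (\<forall>c\<in>C. P c $ i \<noteq> 0). \<Prod>k\<in>supp_vec \<alpha>. (P k $ i) powr (\<alpha> $ k))"
proof -
  \<comment> \<open>Nonemptiness of \<open>C\<close> is essential: an intersection over the empty
    set would contain all natural numbers.\<close>
  have "common_supp P C = {i. i < n \<and> (\<forall>c\<in>C. P c $ i \<noteq> 0)}"
    using assms by (fastforce simp: common_supp_def supp_vec_def)
  then show ?thesis by (simp add: Phi_def)
qed

lemma Phi_eq_if:
  assumes "C \<noteq> {}" and "\<And>c. c \<in> C \<Longrightarrow> dim_vec (P c) = n"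
  shows "Phi \<alpha> C P = (\<Sum>i<n. if \<forall>c\<in>C. P c $ i \<noteq> 0
    then \<Prod>k\<in>supp_vec \<alpha>. (P k $ i) powr (\<alpha> $ k) else 0)"
  using Phi_eq[of C P n \<alpha>] assms by (simp flip: sum.inter_filter)

text \<open>An index pair lies in the common support exactly if both components do, and entries
  multiply, so the sum over pairs factorises.\<close>

lemma Phi_kron:
  assumes "C \<noteq> {}" and "\<And>c. c \<in> C \<Longrightarrow> dim_vec (R c) = l" and "\<And>c. c \<in> C \<Longrightarrow> dim_vec (P c) = n"
    and supp: "supp_vec \<alpha> \<subseteq> C"
    and "\<And>c i. c \<in> C \<Longrightarrow> i < l \<Longrightarrow> 0 \<le> R c $ i" and "\<And>c i. c \<in> C \<Longrightarrow> i < n \<Longrightarrow> 0 \<le> P c $ i"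
  shows "Phi \<alpha> C (\<lambda>k. R k \<otimes>\<^sub>v P k) = Phi \<alpha> C R * Phi \<alpha> C P"
proof -
  let ?f = "\<lambda>P i. if \<forall>c\<in>C. P c $ i \<noteq> 0 then \<Prod>k\<in>supp_vec \<alpha>. (P k $ i) powr (\<alpha> $ k) else 0"
  have "Phi \<alpha> C (\<lambda>k. R k \<otimes>\<^sub>v P k) = (\<Sum>i<l * n. ?f (\<lambda>k. R k \<otimes>\<^sub>v P k) i)"
    by (rule Phi_eq_if) (use assms in auto)
  also have "\<dots> = (\<Sum>i<l. \<Sum>j<n. ?f (\<lambda>k. R k \<otimes>\<^sub>v P k) (i * n + j))"
    by (rule sum_nat_times)
  also have "\<dots> = (\<Sum>i<l. \<Sum>j<n. ?f R i * ?f P j)"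
  proof (intro sum.cong refl)
    fix i j assume "i \<in> {..<l}" "j \<in> {..<n}"
    then have ij: "i < l" "j < n" by auto
    have RP: "(R c \<otimes>\<^sub>v P c) $ (i * n + j) = R c $ i * P c $ j" if "c \<in> C" for c
      using kron_index_pair[of i "R c" j "P c"] assms(2,3)[OF that] ij by simp
    then have "(\<forall>c\<in>C. (R c \<otimes>\<^sub>v P c) $ (i * n + j) \<noteq> 0)
        \<longleftrightarrow> (\<forall>c\<in>C. R c $ i \<noteq> 0) \<and> (\<forall>c\<in>C. P c $ j \<noteq> 0)" by auto
    moreover have "(\<Prod>k\<in>supp_vec \<alpha>. ((R k \<otimes>\<^sub>v P k) $ (i * n + j)) powr (\<alpha> $ k))
        = (\<Prod>k\<in>supp_vec \<alpha>. (R k $ i) powr (\<alpha> $ k) * (P k $ j) powr (\<alpha> $ k))"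
    proof (rule prod.cong[OF refl])
      fix k assume "k \<in> supp_vec \<alpha>"
      then have "k \<in> C" using supp by auto
      then show "((R k \<otimes>\<^sub>v P k) $ (i * n + j)) powr (\<alpha> $ k) = (R k $ i) powr (\<alpha> $ k) * (P k $ j) powr (\<alpha> $ k)"
        using RP assms(5,6) ij by (simp add: powr_mult)
    qed
    ultimately show "?f (\<lambda>k. R k \<otimes>\<^sub>v P k) (i * n + j) = ?f R i * ?f P j"
      by (simp add: prod.distrib)
  qed
  also have "\<dots> = (\<Sum>i<l. ?f R i) * (\<Sum>j<n. ?f P j)"
    by (rule sum_product[symmetric])
  also have "\<dots> = Phi \<alpha> C R * Phi \<alpha> C P"
    using assms by (simp add: Phi_eq_if)
  finally show ?thesis .
qed

text \<open>The comparison is made separately for each target index j: the part of the source sent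
  to j contributes at most the j-th term of the target. Summing over j recovers the source sum
  because T is stochastic.\<close>

lemma Phi_mono:
  assumes T: "tuple_transform d n m P Q" and P: "prob_tuple d n P" and Q: "prob_tuple d m Q"
    and \<alpha>: "prob_vec d \<alpha>" "supp_vec \<alpha> \<subseteq> C" "C \<subseteq> {..<d}"
  shows "Phi \<alpha> C P \<le> Phi \<alpha> C Q"
proof -
  define D where "D = supp_vec \<alpha>"
  have finD: "finite D" by (simp add: D_def supp_vec_def)
  have \<alpha>0: "0 \<le> \<alpha> $ k" if "k \<in> D" for k using \<alpha>(1) that by (auto simp: prob_vec_def D_def supp_vec_def)
  have "(\<Sum>k\<in>D. \<alpha> $ k) = (\<Sum>k<d. \<alpha> $ k)"
    using \<alpha>(1) by (intro sum.mono_neutral_left) (auto simp: D_def supp_vec_def prob_vec_def)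
  then have \<alpha>1: "(\<Sum>k\<in>D. \<alpha> $ k) = 1" using \<alpha>(1) by (simp add: prob_vec_def)
  then have "D \<noteq> {}" by auto
  then have C: "C \<noteq> {}" using \<alpha>(2) by (auto simp: D_def)
  have DC: "c < d" if "c \<in> C" for c using \<alpha>(3) that by auto
  have kC: "k \<in> C" if "k \<in> D" for k using \<alpha>(2) that by (auto simp: D_def)
  have dimP: "dim_vec (P k) = n" and P0: "\<And>i. i < n \<Longrightarrow> 0 \<le> P k $ i" if "k < d" for k
    using P that by (auto simp: prob_tuple_def prob_vec_def)
  have dimQ: "dim_vec (Q k) = m" and Q0: "\<And>i. i < m \<Longrightarrow> 0 \<le> Q k $ i" if "k < d" for k
    using Q that by (auto simp: prob_tuple_def prob_vec_def)
  obtain T where T0: "\<And>i j. i < n \<Longrightarrow> j < m \<Longrightarrow> 0 \<le> T i j"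
    and T1: "\<And>i. i < n \<Longrightarrow> (\<Sum>j<m. T i j) = (1::real)"
    and TQ: "\<And>k j. k < d \<Longrightarrow> j < m \<Longrightarrow> (\<Sum>i<n. T i j * P k $ i) = Q k $ j"
    using tuple_transformE[OF T dimP] by metis
  let ?f = "\<lambda>P i. \<Prod>k\<in>D. (P k $ i) powr (\<alpha> $ k)"
  let ?I = "{i. i < n \<and> (\<forall>c\<in>C. P c $ i \<noteq> 0)}"
  have column: "(\<Sum>i\<in>?I. T i j * ?f P i) \<le> (if \<forall>c\<in>C. Q c $ j \<noteq> 0 then ?f Q j else 0)"
    if j: "j < m" for j
  proof (cases "\<forall>c\<in>C. Q c $ j \<noteq> 0")
    \<comment> \<open>If \<open>Q c\<close> vanishes at j, nothing seen by \<open>P c\<close> can be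
      sent to j; every index in \<open>?I\<close> is seen by \<open>P c\<close>, so the left-hand
      side is 0.\<close>
    case False
    then obtain c where c: "c \<in> C" "Q c $ j = 0" by auto
    have "\<forall>i\<in>{..<n}. T i j * P c $ i = 0"
      using TQ[OF DC[OF c(1)] j] c T0 j P0[OF DC[OF c(1)]]
      by (subst (asm) c(2), subst (asm) sum_nonneg_eq_0_iff) auto
    then have "(\<Sum>i\<in>?I. T i j * ?f P i) = 0" using c by (intro sum.neutral) auto
    then show ?thesis unfolding if_not_P[OF False] by simp
  next
    case True
    then have Qpos: "0 < Q k $ j" if "k \<in> D" for k
      using Q0[of k j] DC[OF kC[OF that]] kC[OF that] j by (auto simp: less_le)
    have Qprod: "0 < ?f Q j" using Qpos by (intro prod_pos) (auto dest: Qpos)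
    \<comment> \<open>After division by the target term, the mean inequality replaces geometric
      means of the ratios by arithmetic ones. These are linear in \<open>P k\<close>, so the action
      of T turns them into \<open>Q k $ j / Q k $ j\<close>.\<close>
    have "(\<Sum>i\<in>?I. T i j * (?f P i / ?f Q j)) \<le> (\<Sum>i\<in>?I. T i j * (\<Sum>k\<in>D. \<alpha> $ k * (P k $ i / Q k $ j)))"
    proof (intro sum_mono mult_left_mono)
      fix i assume i: "i \<in> ?I"
      have Ppos: "0 < P k $ i" if "k \<in> D" for k
        using P0[of k i] DC[OF kC[OF that]] kC[OF that] i by (auto simp: less_le)
      have "?f P i / ?f Q j = (\<Prod>k\<in>D. (P k $ i / Q k $ j) powr (\<alpha> $ k))"
        using Ppos Qpos by (simp add: powr_divide less_imp_le flip: prod_dividef)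
      also have "\<dots> \<le> (\<Sum>k\<in>D. \<alpha> $ k * (P k $ i / Q k $ j))"
        using finD \<alpha>0 \<alpha>1 Ppos Qpos by (intro weighted_arith_geom_mean) auto
      finally show "?f P i / ?f Q j \<le> (\<Sum>k\<in>D. \<alpha> $ k * (P k $ i / Q k $ j))" .
    qed (use T0 j in auto)
    also have "\<dots> \<le> (\<Sum>i<n. T i j * (\<Sum>k\<in>D. \<alpha> $ k * (P k $ i / Q k $ j)))"
      using T0 j \<alpha>0 P0 Qpos DC kC
      by (intro sum_mono2) (auto intro!: mult_nonneg_nonneg sum_nonneg divide_nonneg_pos)
    also have "\<dots> = (\<Sum>k\<in>D. \<alpha> $ k * ((\<Sum>i<n. T i j * P k $ i) / Q k $ j))"
      by (simp add: sum_distrib_left sum_divide_distrib) (subst sum.swap, simp add: mult_ac)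
    also have "\<dots> = (\<Sum>k\<in>D. \<alpha> $ k)"
    proof (rule sum.cong[OF refl])
      fix k assume k: "k \<in> D"
      show "\<alpha> $ k * ((\<Sum>i<n. T i j * P k $ i) / Q k $ j) = \<alpha> $ k"
        using TQ[OF DC[OF kC[OF k]] j] Qpos[OF k] by simp
    qed
    finally have "(\<Sum>i\<in>?I. T i j * ?f P i) / ?f Q j \<le> 1"
      using \<alpha>1 by (simp add: sum_divide_distrib)
    then show ?thesis using Qprod True by (simp add: pos_divide_le_eq)
  qed
  have "Phi \<alpha> C P = (\<Sum>i\<in>?I. ?f P i)"
    using Phi_eq[OF C, of P n \<alpha>] DC dimP by (simp add: D_def)
  also have "\<dots> = (\<Sum>i\<in>?I. (\<Sum>j<m. T i j) * ?f P i)" using T1 by simp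
  also have "\<dots> = (\<Sum>j<m. \<Sum>i\<in>?I. T i j * ?f P i)"
    unfolding sum_distrib_right by (rule sum.swap)
  also have "\<dots> \<le> (\<Sum>j<m. if \<forall>c\<in>C. Q c $ j \<noteq> 0 then ?f Q j else 0)"
    using column by (intro sum_mono) auto
  also have "\<dots> = Phi \<alpha> C Q"
    unfolding D_def by (rule Phi_eq_if[OF C, symmetric]) (use DC dimQ in auto)
  finally show ?thesis .
qed

text \<open>A common index makes at least one term occur, and every occurring term is positive.
  Applied to a catalyst, this allows its factor to be cancelled.\<close>

lemma Phi_pos:
  assumes "common_supp P {..<d} \<noteq> {}" and P: "prob_tuple d n P"
    and C: "supp_vec \<alpha> \<subseteq> C" "C \<subseteq> {..<d}" "C \<noteq> {}"
  shows "0 < Phi \<alpha> C P"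
proof -
  have "common_supp P {..<d} \<subseteq> common_supp P C" using C(2) by (auto simp: common_supp_def)
  then have ne: "common_supp P C \<noteq> {}" using assms(1) by auto
  obtain c where "c \<in> C" using C(3) by auto
  then have "common_supp P C \<subseteq> supp_vec (P c)" by (auto simp: common_supp_def)
  then have fin: "finite (common_supp P C)" by (rule finite_subset) (simp add: supp_vec_def)
  show ?thesis
    unfolding Phi_def
  proof (rule sum_pos[OF fin ne], rule prod_pos)
    fix i k assume i: "i \<in> common_supp P C" and k: "k \<in> supp_vec \<alpha>"
    then have "i \<in> supp_vec (P k)" using C(1) by (auto simp: common_supp_def)
    then show "0 < (P k $ i) powr (\<alpha> $ k)" by (auto simp: supp_vec_def)
  qed
qed

lemma Phi_mono_catalyst:
  assumes "is_catalyst d n m P Q l R" and P: "prob_tuple d n P" and Q: "prob_tuple d m Q"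
    and \<alpha>: "prob_vec d \<alpha>" "supp_vec \<alpha> \<subseteq> C" "C \<subseteq> {..<d}"
  shows "Phi \<alpha> C P \<le> Phi \<alpha> C Q"
proof -
  have R: "prob_tuple d l R" and supp: "common_supp R {..<d} \<noteq> {}"
    and T: "tuple_transform d (l * n) (l * m) (\<lambda>k. R k \<otimes>\<^sub>v P k) (\<lambda>k. R k \<otimes>\<^sub>v Q k)"
    using assms(1) by (auto simp: is_catalyst_def)
  have "\<exists>k<d. \<alpha> $ k \<noteq> 0" using \<alpha>(1) by (metis lessThan_iff prob_vec_def sum.neutral zero_neq_one)
  then have C: "C \<noteq> {}" using \<alpha> by (auto simp: supp_vec_def prob_vec_def)
  have tuple: "prob_vec l (R c)" "prob_vec n (P c)" "prob_vec m (Q c)" if "c \<in> C" for c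
    using R P Q \<alpha>(3) that by (auto simp: prob_tuple_def)
  have "Phi \<alpha> C R * Phi \<alpha> C P = Phi \<alpha> C (\<lambda>k. R k \<otimes>\<^sub>v P k)"
    by (rule Phi_kron[symmetric, where l = l and n = n]) (use C \<alpha> tuple in \<open>auto simp: prob_vec_def\<close>)
  also have "\<dots> \<le> Phi \<alpha> C (\<lambda>k. R k \<otimes>\<^sub>v Q k)"
    by (rule Phi_mono[OF T _ _ \<alpha>]) (use R P Q prob_vec_kron in \<open>auto simp: prob_tuple_def\<close>)
  also have "\<dots> = Phi \<alpha> C R * Phi \<alpha> C Q"
    by (rule Phi_kron[where l = l and n = m]) (use C \<alpha> tuple in \<open>auto simp: prob_vec_def\<close>)
  finally show ?thesis using Phi_pos[OF supp R \<alpha>(2,3) C] by simp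
qed

section \<open>Powers of tuples\<close>

text \<open>Once the outcomes seen by at least two of the distributions have been placed below the target,
  the outcomes seen by a single distribution can be used to fill up the remainder exactly.\<close>
lemma fill_remainder:
  fixes p :: "nat \<Rightarrow> 'a \<Rightarrow> real" and q :: "nat \<Rightarrow> 'b \<Rightarrow> real" and d :: nat
  defines "S \<equiv> \<lambda>x. {k. k < d \<and> p k x \<noteq> 0}"
  assumes X: "finite X" and Y: "finite Y" "Y \<noteq> {}"
    and p0: "\<And>k x. k < d \<Longrightarrow> x \<in> X \<Longrightarrow> 0 \<le> p k x" and p1: "\<And>k. k < d \<Longrightarrow> (\<Sum>x\<in>X. p k x) = 1"
    and q1: "\<And>k. k < d \<Longrightarrow> (\<Sum>y\<in>Y. q k y) = 1"
    and \<tau>0: "\<And>x y. x \<in> X \<Longrightarrow> 2 \<le> card (S x) \<Longrightarrow> y \<in> Y \<Longrightarrow> 0 \<le> \<tau> x y"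
    and \<tau>1: "\<And>x. x \<in> X \<Longrightarrow> 2 \<le> card (S x) \<Longrightarrow> (\<Sum>y\<in>Y. \<tau> x y) = 1"
    and cap: "\<And>k y. k < d \<Longrightarrow> y \<in> Y \<Longrightarrow> (\<Sum>x | x \<in> X \<and> 2 \<le> card (S x). \<tau> x y * p k x) \<le> q k y"
  obtains T where "\<And>x y. x \<in> X \<Longrightarrow> y \<in> Y \<Longrightarrow> (0::real) \<le> T x y"
    and "\<And>x. x \<in> X \<Longrightarrow> (\<Sum>y\<in>Y. T x y) = 1"
    and "\<And>k y. k < d \<Longrightarrow> y \<in> Y \<Longrightarrow> (\<Sum>x\<in>X. T x y * p k x) = q k y"
proof -
  obtain y0 where y0: "y0 \<in> Y" using Y by auto
  have finS: "finite (S x)" for x by (simp add: S_def)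
  define M where "M = {x \<in> X. 2 \<le> card (S x)}"
  define R where "R k y = q k y - (\<Sum>x\<in>M. \<tau> x y * p k x)" for k y
  define \<rho> where "\<rho> k = (\<Sum>y\<in>Y. R k y)" for k
  \<comment> \<open>An outcome seen by k alone is spread in proportion to the remainder
    \<open>R k\<close>. An outcome seen by nobody has probability 0 throughout; its row only has to
    be a distribution, and y0 is an arbitrary target.\<close>
  define T where "T x y = (if 2 \<le> card (S x) then \<tau> x y
    else if S x = {} then of_bool (y = y0)
    else R (the_elem (S x)) y / \<rho> (the_elem (S x)))" for x y
  have M: "finite M" "M \<subseteq> X" using X by (auto simp: M_def)
  have single: "S x = {k}" if "x \<in> X - M" "p k x \<noteq> 0" "k < d" for x k
  proof -
    have k: "k \<in> S x" and "card (S x) \<le> 1" using that by (auto simp: S_def M_def)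
    moreover have "0 < card (S x)" using k finS by (auto simp: card_gt_0_iff)
    ultimately have "card (S x) = 1" by linarith
    then obtain c where "S x = {c}" by (rule card_1_singletonE)
    with k show ?thesis by simp
  qed
  have S1: "\<exists>k<d. S x = {k} \<and> p k x \<noteq> 0" if x: "x \<in> X" "\<not> 2 \<le> card (S x)" "S x \<noteq> {}" for x
  proof -
    obtain k where k: "k \<in> S x" using x(3) by auto
    then have "k < d" "p k x \<noteq> 0" by (auto simp: S_def)
    moreover have "x \<in> X - M" using x by (simp add: M_def)
    ultimately show ?thesis using single[of x k] by blast
  qed
  have R0: "0 \<le> R k y" if "k < d" "y \<in> Y" for k y
    using cap[OF that] by (simp add: R_def M_def)
  \<comment> \<open>Conservation of mass: what is missing from the target k is the mass of the
    outcomes seen by k alone.\<close>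
  have \<rho>: "\<rho> k = (\<Sum>x\<in>X - M. p k x)" if "k < d" for k
  proof -
    have "(\<Sum>y\<in>Y. \<Sum>x\<in>M. \<tau> x y * p k x) = (\<Sum>x\<in>M. (\<Sum>y\<in>Y. \<tau> x y) * p k x)"
      by (subst sum.swap) (simp add: sum_distrib_right)
    also have "\<dots> = (\<Sum>x\<in>M. p k x)" using \<tau>1 by (intro sum.cong) (auto simp: M_def)
    finally show ?thesis
      using p1[OF that] q1[OF that] sum.subset_diff[OF M(2) X, of "p k"]
      by (simp add: \<rho>_def R_def sum_subtractf)
  qed
  have \<rho>0: "0 < \<rho> k" if k: "k < d" "p k x \<noteq> 0" and x: "x \<in> X - M" for k x
  proof -
    have "p k x \<le> \<rho> k"
      unfolding \<rho>[OF k(1)] using X p0 k(1) x by (intro member_le_sum) auto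
    moreover have "0 < p k x" using p0[OF k(1), of x] k x by auto
    ultimately show ?thesis by linarith
  qed
  show ?thesis
  proof (rule that)
    fix x y assume x: "x \<in> X" and y: "y \<in> Y"
    show "0 \<le> T x y"
    proof (cases "2 \<le> card (S x) \<or> S x = {}")
      case False
      then obtain k where k: "k < d" "S x = {k}" "p k x \<noteq> 0" using S1[of x] x by auto
      then show ?thesis
        using R0[OF k(1) y] \<rho>0[OF k(1,3)] x False by (simp add: T_def M_def)
    qed (use \<tau>0 x y in \<open>auto simp: T_def\<close>)
  next
    fix x assume x: "x \<in> X"
    show "(\<Sum>y\<in>Y. T x y) = 1"
    proof (cases "2 \<le> card (S x) \<or> S x = {}")
      case False
      then obtain k where k: "k < d" "S x = {k}" "p k x \<noteq> 0" using S1[of x] x by auto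
      then show ?thesis
        using \<rho>0[OF k(1,3)] x False
        by (simp add: T_def M_def \<rho>_def flip: sum_divide_distrib)
    qed (use \<tau>1 x y0 Y in \<open>auto simp: T_def\<close>)
  next
    fix k y assume k: "k < d" and y: "y \<in> Y"
    have "(\<Sum>x\<in>X. T x y * p k x) = (\<Sum>x\<in>X - M. T x y * p k x) + (\<Sum>x\<in>M. T x y * p k x)"
      using sum.subset_diff[OF M(2) X] .
    also have "(\<Sum>x\<in>M. T x y * p k x) = (\<Sum>x\<in>M. \<tau> x y * p k x)"
      by (rule sum.cong) (auto simp: T_def M_def)
    also have "(\<Sum>x\<in>X - M. T x y * p k x) = (\<Sum>x\<in>X - M. R k y / \<rho> k * p k x)"
    proof (rule sum.cong[OF refl])
      fix x assume x: "x \<in> X - M"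
      show "T x y * p k x = R k y / \<rho> k * p k x"
      proof (cases "p k x = 0")
        case False
        then have "S x = {k}" using single x k by blast
        then show ?thesis by (simp add: T_def)
      qed simp
    qed
    also have "\<dots> = R k y / \<rho> k * \<rho> k" by (simp add: \<rho>[OF k] sum_distrib_left)
    also have "\<dots> = R k y"
    \<comment> \<open>For \<rho> k = 0 the quotient is 0 by convention, which is right because the
      nonnegative remainders then sum to 0.\<close>
    proof (cases "\<rho> k = 0")
      case True
      then have "\<forall>y\<in>Y. R k y = 0"
        using R0[OF k] Y unfolding \<rho>_def by (subst (asm) sum_nonneg_eq_0_iff) auto
      then show ?thesis using y by simp
    qed simp
    finally show "(\<Sum>x\<in>X. T x y * p k x) = q k y" by (simp add: R_def)
  qed
qed

section \<open>Stochastic maps between words\<close>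

lemma prod_list_map_eq_0_iff:
  fixes g :: "'a \<Rightarrow> real"
  shows "prod_list (map g xs) = 0 \<longleftrightarrow> (\<exists>x\<in>set xs. g x = 0)"
  by (auto simp: prod_list_zero_iff)

text \<open>The products run over all of \<open>C\<close> instead of the support of \<alpha>, so
  that both sides are continuous in \<alpha> up to the faces; on the summation ranges all bases are
  nonzero, and a zero exponent contributes the factor 1.\<close>

lemma eventually_words_transform:
  fixes p :: "nat \<Rightarrow> 'a \<Rightarrow> real" and q :: "nat \<Rightarrow> 'b \<Rightarrow> real" and d :: nat
  assumes A: "finite A" and B: "finite B" and B0: "\<exists>j\<in>B. \<forall>k<d. q k j \<noteq> 0"
    and p0: "\<And>k i. k < d \<Longrightarrow> i \<in> A \<Longrightarrow> 0 \<le> p k i" and p1: "\<And>k. k < d \<Longrightarrow> (\<Sum>i\<in>A. p k i) = 1"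
    and q0: "\<And>k j. k < d \<Longrightarrow> j \<in> B \<Longrightarrow> 0 \<le> q k j" and q1: "\<And>k. k < d \<Longrightarrow> (\<Sum>j\<in>B. q k j) = 1"
    and less: "\<And>C \<alpha>. C \<subseteq> {..<d} \<Longrightarrow> 2 \<le> card C \<Longrightarrow> \<alpha> \<in> simplex_on C \<Longrightarrow>
      (\<Sum>i | i \<in> A \<and> (\<forall>k\<in>C. p k i \<noteq> 0). \<Prod>k\<in>C. p k i powr \<alpha> k)
      < (\<Sum>j | j \<in> B \<and> (\<forall>k\<in>C. q k j \<noteq> 0). \<Prod>k\<in>C. q k j powr \<alpha> k)"
  shows "\<forall>\<^sub>F N in sequentially. \<exists>T.
    (\<forall>x\<in>words A N. \<forall>y\<in>words B N. (0::real) \<le> T x y) \<and> (\<forall>x\<in>words A N. (\<Sum>y\<in>words B N. T x y) = 1) \<and>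
    (\<forall>k<d. \<forall>y\<in>words B N. (\<Sum>x\<in>words A N. T x y * prod_list (map (p k) x)) = prod_list (map (q k) y))"
proof -
  define A' where "A' C = {i \<in> A. \<forall>k\<in>C. p k i \<noteq> 0}" for C
  define B' where "B' C = {j \<in> B. \<forall>k\<in>C. q k j \<noteq> 0}" for C
  define P where "P k xs = prod_list (map (p k) xs)" for k xs
  define Q where "Q k ys = prod_list (map (q k) ys)" for k ys
  define \<C> where "\<C> = {C. C \<subseteq> {..<d} \<and> 2 \<le> card C}"
  have fin\<C>: "finite C" "C \<noteq> {}" "B' C \<noteq> {}" if "C \<in> \<C>" for C
    using that B0 finite_subset[of C "{..<d}"] by (auto simp: \<C>_def B'_def subset_iff)
  have p_pos: "0 < p k i" if "C \<in> \<C>" "k \<in> C" "i \<in> A' C" for C k i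
    using p0[of k i] that by (force simp: \<C>_def A'_def)
  have q_pos: "0 < q k j" if "C \<in> \<C>" "k \<in> C" "j \<in> B' C" for C k j
    using q0[of k j] that by (force simp: \<C>_def B'_def)
  have "finite \<C>" by (rule finite_subset[of _ "Pow {..<d}"]) (auto simp: \<C>_def)
  moreover have "\<forall>\<^sub>F N in sequentially. \<forall>a. (\<forall>k\<in>C. 0 < a k) \<longrightarrow>
      (\<forall>\<alpha>\<in>simplex_on C. (\<Prod>k\<in>C. a k powr \<alpha> k) \<le> (\<Sum>i\<in>A' C. \<Prod>k\<in>C. p k i powr \<alpha> k) ^ N) \<longrightarrow>
      real (N + 1) ^ card A \<le> (\<Sum>ys\<in>words (B' C) N. Min ((\<lambda>k. prod_list (map (q k) ys) / a k) ` C))"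
    if C: "C \<in> \<C>" for C
    using fin\<C>[OF C] p_pos[OF C] q_pos[OF C] less[of C] C B
    by (intro eventually_overlap_ge) (auto simp: \<C>_def A'_def B'_def)
  \<comment> \<open>There are finitely many sets \<open>C\<close>, so a single threshold for N
    serves them all.\<close>
  ultimately have "\<forall>\<^sub>F N in sequentially. \<forall>C\<in>\<C>. \<forall>a. (\<forall>k\<in>C. 0 < a k) \<longrightarrow>
      (\<forall>\<alpha>\<in>simplex_on C. (\<Prod>k\<in>C. a k powr \<alpha> k) \<le> (\<Sum>i\<in>A' C. \<Prod>k\<in>C. p k i powr \<alpha> k) ^ N) \<longrightarrow>
      real (N + 1) ^ card A \<le> (\<Sum>ys\<in>words (B' C) N. Min ((\<lambda>k. Q k ys / a k) ` C))"
    unfolding Q_def by (simp add: eventually_ball_finite)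
  then show ?thesis
  proof eventually_elim
    case (elim N)
    let ?X = "words A N" and ?Y = "words B N"
    have P0: "0 \<le> P k x" if "k < d" "x \<in> ?X" for k x
      using that p0 by (auto simp: P_def words_def subset_iff intro!: prod_list_nonneg)
    have Q0: "0 \<le> Q k y" if "k < d" "y \<in> ?Y" for k y
      using that q0 by (auto simp: Q_def words_def subset_iff intro!: prod_list_nonneg)
    define S where "S x = {k. k < d \<and> P k x \<noteq> 0}" for x
    define f where "f x = restrict (count_list x) A" for x
    define cls where "cls x = {x' \<in> ?X. f x' = f x}" for x
    \<comment> \<open>Since \<open>P k\<close> is constant on the type class, this is the mass of
      the class under \<open>P k\<close>.\<close>
    define a where "a x k = card (cls x) * P k x" for x k
    define \<mu> where "\<mu> x y = Min ((\<lambda>k. Q k y / a x k) ` S x)" for x y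
    define Z where "Z x = (\<Sum>y\<in>words (B' (S x)) N. \<mu> x y)" for x
    define \<tau> where "\<tau> x y = (if y \<in> words (B' (S x)) N then \<mu> x y / Z x else 0)" for x y
    have B'_sub: "words (B' C) N \<subseteq> ?Y" for C by (auto simp: words_def B'_def)
    have cls0: "0 < card (cls x)" if "x \<in> ?X" for x
      using that A by (auto simp: card_gt_0_iff cls_def)
    have P_cls: "P k x' = P k x" if x: "x \<in> ?X" and x': "x' \<in> cls x" for k x x'
    proof -
      have "count_list x' i = count_list x i" if "i \<in> A" for i
      proof -
        have "f x' = f x" using x' by (simp add: cls_def)
        then have "f x' i = f x i" by simp
        then show ?thesis using that by (simp add: f_def)
      qed
      moreover have "set x \<subseteq> A" "set x' \<subseteq> A" using x x' by (auto simp: cls_def words_def)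
      ultimately show ?thesis by (simp add: P_def prod_list_map_count[OF A])
    qed
    have S\<C>: "S x \<in> \<C>" if "2 \<le> card (S x)" for x
      using that unfolding \<C>_def S_def by blast
    have a0: "0 < a x k" if "x \<in> ?X" "k \<in> S x" for x k
    proof -
      have "k < d" "P k x \<noteq> 0" using that(2) by (simp_all add: S_def)
      then have "0 < P k x" using P0[of k x] that(1) by linarith
      then show ?thesis using cls0[OF that(1)] by (simp add: a_def)
    qed
    have Z: "real (N + 1) ^ card A \<le> Z x" if x: "x \<in> ?X" and S: "2 \<le> card (S x)" for x
      unfolding Z_def \<mu>_def
    proof (rule elim[rule_format, OF S\<C>[OF S]])
      fix \<alpha> assume \<alpha>: "\<alpha> \<in> simplex_on (S x)"
      have \<alpha>1: "(\<Sum>k\<in>S x. \<alpha> k) = 1" using \<alpha> by (simp add: simplex_on_def)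
      have finS: "finite (S x)" by (simp add: S_def)
      let ?c = "card (cls x)"
      \<comment> \<open>As \<alpha> sums to 1, the class size comes out exactly once, and the
        weighted geometric mean of the masses is the contribution of the class to a sum over all
        words seen by all of \<open>S x\<close>. That full sum is the N-th power of the sum over
        letters.\<close>
      have "(\<Prod>k\<in>S x. a x k powr \<alpha> k) = (\<Prod>k\<in>S x. real ?c powr \<alpha> k) * (\<Prod>k\<in>S x. P k x powr \<alpha> k)"
        using P0 x by (simp add: a_def powr_mult S_def flip: prod.distrib)
      also have "(\<Prod>k\<in>S x. real ?c powr \<alpha> k) = real ?c powr (\<Sum>k\<in>S x. \<alpha> k)"
        using cls0[OF x] finS by (simp add: powr_sum)
      also have "\<dots> = real ?c" using \<alpha>1 cls0[OF x] by simp
      also have "real ?c * (\<Prod>k\<in>S x. P k x powr \<alpha> k) = (\<Sum>x'\<in>cls x. \<Prod>k\<in>S x. P k x' powr \<alpha> k)"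
        using P_cls[OF x] by simp
      also have "\<dots> \<le> (\<Sum>x'\<in>words (A' (S x)) N. \<Prod>k\<in>S x. P k x' powr \<alpha> k)"
      proof (rule sum_mono2)
        show "finite (words (A' (S x)) N)" using A by (simp add: A'_def)
        show "cls x \<subseteq> words (A' (S x)) N"
        proof
          fix x' assume x': "x' \<in> cls x"
          then have "\<forall>k\<in>S x. P k x' \<noteq> 0" using P_cls[OF x x'] by (auto simp: S_def)
          then show "x' \<in> words (A' (S x)) N"
            using x' by (auto simp: P_def prod_list_map_eq_0_iff words_def cls_def A'_def)
        qed
      qed (auto intro: prod_nonneg)
      also have "\<dots> = (\<Sum>x'\<in>words (A' (S x)) N. prod_list (map (\<lambda>i. \<Prod>k\<in>S x. p k i powr \<alpha> k) x'))"
      proof (rule sum.cong[OF refl])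
        fix x' assume "x' \<in> words (A' (S x)) N"
        then have x': "set x' \<subseteq> A' (S x)" by (simp add: words_def)
        have "P k x' powr \<alpha> k = prod_list (map (\<lambda>i. p k i powr \<alpha> k) x')" if k: "k \<in> S x" for k
          using x'
        proof (induction x')
          case (Cons i x')
          have "0 \<le> P k x'" "0 \<le> p k i"
            using Cons.prems p0[of k] k by (auto simp: P_def A'_def S_def subset_iff intro!: prod_list_nonneg)
          then show ?case using Cons by (simp add: P_def powr_mult)
        qed (simp add: P_def)
        then have "(\<Prod>k\<in>S x. P k x' powr \<alpha> k) = (\<Prod>k\<in>S x. prod_list (map (\<lambda>i. p k i powr \<alpha> k) x'))"
          by simp
        also have "\<dots> = prod_list (map (\<lambda>i. \<Prod>k\<in>S x. p k i powr \<alpha> k) x')"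
          by (induction x') (simp_all add: prod.distrib)
        finally show "(\<Prod>k\<in>S x. P k x' powr \<alpha> k) = prod_list (map (\<lambda>i. \<Prod>k\<in>S x. p k i powr \<alpha> k) x')" .
      qed
      also have "\<dots> = (\<Sum>i\<in>A' (S x). \<Prod>k\<in>S x. p k i powr \<alpha> k) ^ N"
        by (rule sum_words_prod_list)
      finally show "(\<Prod>k\<in>S x. a x k powr \<alpha> k) \<le> (\<Sum>i\<in>A' (S x). \<Prod>k\<in>S x. p k i powr \<alpha> k) ^ N" .
    qed (use a0 x in auto)
    have Z0: "0 < Z x" if x: "x \<in> ?X" and S: "2 \<le> card (S x)" for x
      using Z[OF that] by (rule less_le_trans[rotated]) simp
    have \<mu>0: "0 \<le> \<mu> x y" if x: "x \<in> ?X" and S: "2 \<le> card (S x)" and y: "y \<in> ?Y" for x y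
      unfolding \<mu>_def using fin\<C>[OF S\<C>[OF S]] a0[OF x] Q0[OF _ y]
      by (intro Min.boundedI) (auto simp: S_def less_imp_le)
    obtain T where "\<And>x y. x \<in> ?X \<Longrightarrow> y \<in> ?Y \<Longrightarrow> (0::real) \<le> T x y"
      "\<And>x. x \<in> ?X \<Longrightarrow> (\<Sum>y\<in>?Y. T x y) = 1"
      "\<And>k y. k < d \<Longrightarrow> y \<in> ?Y \<Longrightarrow> (\<Sum>x\<in>?X. T x y * P k x) = Q k y"
    proof (rule fill_remainder[of ?X ?Y d P Q \<tau>, folded S_def])
      show "finite ?X" "finite ?Y" using A B by auto
      obtain j where "j \<in> B" using B0 by auto
      then have "replicate N j \<in> ?Y" by (auto simp: words_def)
      then show "?Y \<noteq> {}" by blast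
      show "(\<Sum>x\<in>?X. P k x) = 1" if "k < d" for k
        using p1[OF that] by (simp add: P_def sum_words_prod_list)
      show "(\<Sum>y\<in>?Y. Q k y) = 1" if "k < d" for k
        using q1[OF that] by (simp add: Q_def sum_words_prod_list)
      fix x assume x: "x \<in> ?X" and S: "2 \<le> card (S x)"
      show "0 \<le> \<tau> x y" if "y \<in> ?Y" for y
        using \<mu>0[OF x S that] Z0[OF x S] by (simp add: \<tau>_def)
      have "(\<Sum>y\<in>?Y. \<tau> x y) = (\<Sum>y\<in>words (B' (S x)) N. \<mu> x y / Z x)"
        unfolding \<tau>_def using B B'_sub by (intro sum.mono_neutral_cong_right) auto
      also have "\<dots> = 1" using Z0[OF x S] by (simp add: Z_def flip: sum_divide_distrib)
      finally show "(\<Sum>y\<in>?Y. \<tau> x y) = 1" .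
    next
      fix k y assume k: "k < d" and y: "y \<in> ?Y"
      let ?M = "real (N + 1) ^ card A"
      have "\<tau> x y * P k x \<le> Q k y / ?M * (1 / real (card {x' \<in> ?X. f x' = f x}))"
        if x: "x \<in> ?X" and S: "2 \<le> card (S x)" for x
      proof (cases "k \<in> S x \<and> y \<in> words (B' (S x)) N")
        case True
        have "\<mu> x y \<le> Q k y / a x k"
          unfolding \<mu>_def using True fin\<C>[OF S\<C>[OF S]] by (intro Min_le) auto
        \<comment> \<open>The numerator is bounded by its k-th quotient and the overlap
          \<open>Z x\<close> from below. Multiplied by \<open>P k x\<close>, the division by
          \<open>a x k\<close> leaves one over the size of the type class.\<close>
        then have "\<mu> x y / Z x \<le> (Q k y / a x k) / ?M"
          using Z[OF x S] Q0[OF k y] a0[OF x, of k] True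
          by (intro frac_le) (auto intro!: divide_nonneg_pos)
        then have "\<mu> x y / Z x * P k x \<le> (Q k y / a x k) / ?M * P k x"
          using P0[OF k x] by (rule mult_right_mono)
        also have "\<dots> = Q k y / ?M * (1 / real (card (cls x)))"
          using True cls0[OF x] by (simp add: a_def S_def field_simps)
        finally show ?thesis using True by (simp add: \<tau>_def cls_def)
      next
        case False
        then have zero: "\<tau> x y * P k x = 0" using k by (auto simp: \<tau>_def S_def)
        show ?thesis
          unfolding zero using Q0[OF k y] by (intro mult_nonneg_nonneg divide_nonneg_nonneg) auto
      qed
      then have "(\<Sum>x | x \<in> ?X \<and> 2 \<le> card (S x). \<tau> x y * P k x)
          \<le> (\<Sum>x | x \<in> ?X \<and> 2 \<le> card (S x). Q k y / ?M * (1 / real (card {x' \<in> ?X. f x' = f x})))"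
        by (intro sum_mono) auto
      also have "\<dots> \<le> (\<Sum>x\<in>?X. Q k y / ?M * (1 / real (card {x' \<in> ?X. f x' = f x})))"
        using A Q0[OF k y] by (intro sum_mono2) auto
      \<comment> \<open>Each type class uses at most the fraction \<open>1 / ?M\<close> of
        \<open>Q k y\<close>, and there are at most \<open>?M\<close> classes.\<close>
      also have "\<dots> = Q k y / ?M * real (card (f ` ?X))"
        using A by (simp only: sum_inverse_fibre_card finite_words flip: sum_distrib_left)
      also have "\<dots> \<le> Q k y / ?M * ?M"
      proof (rule mult_left_mono)
        have "card (f ` ?X) \<le> (N + 1) ^ card A" unfolding f_def by (rule card_types_le[OF A])
        then show "real (card (f ` ?X)) \<le> ?M" by (metis of_nat_le_iff of_nat_power)
      qed (use Q0[OF k y] in simp)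
      finally show "(\<Sum>x | x \<in> ?X \<and> 2 \<le> card (S x). \<tau> x y * P k x) \<le> Q k y" by simp
    qed (use P0 in auto)
    then show ?case unfolding P_def Q_def by blast
  qed
qed

text \<open>One numbering of the words works for all vectors v simultaneously, so a single kernel on
  words becomes a single matrix for all members of the tuple.\<close>

lemma ex_kron_pow_index:
  "\<exists>e. bij_betw e (words {..<n} N) {..<n ^ N} \<and>
    (\<forall>v xs. dim_vec v = n \<longrightarrow> xs \<in> words {..<n} N \<longrightarrow> kron_pow v N $ e xs = prod_list (map (($) v) xs))"
proof (induction N)
  case 0
  show ?case by (auto intro!: exI[where x = "\<lambda>_. 0"] simp: bij_betw_def)
next
  case (Suc N)
  then obtain e where e: "bij_betw e (words {..<n} N) {..<n ^ N}"
    and v: "\<And>v xs. dim_vec v = n \<Longrightarrow> xs \<in> words {..<n} N \<Longrightarrow>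
      kron_pow v N $ e xs = prod_list (map (($) v) xs)" by blast
  define e' where "e' xs = hd xs * n ^ N + e (tl xs)" for xs
  have "bij_betw (\<lambda>xs. (hd xs, tl xs)) (words {..<n} (Suc N)) ({..<n} \<times> words {..<n} N)"
    by (rule bij_betw_byWitness[where f' = "\<lambda>(x, xs). x # xs"])
      (auto simp: words_def length_Suc_conv)
  from bij_betw_trans[OF bij_betw_trans[OF this bij_betw_map_prod[OF bij_betw_id e]]
      bij_betw_kron_index[of "n ^ N" n]]
  have "bij_betw e' (words {..<n} (Suc N)) {..<n ^ Suc N}"
    by (simp add: comp_def case_prod_unfold e'_def[abs_def])
  moreover have "kron_pow v (Suc N) $ e' xs = prod_list (map (($) v) xs)"
    if dim: "dim_vec v = n" and xs: "xs \<in> words {..<n} (Suc N)" for v xs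
  proof -
    obtain y ys where ys: "xs = y # ys" "y < n" "ys \<in> words {..<n} N"
      using xs by (auto simp: words_def length_Suc_conv)
    have "e ys < n ^ N" using e ys(3) by (auto simp: bij_betw_def)
    then show ?thesis
      using kron_index_pair[of y v "e ys" "kron_pow v N"] v[OF dim ys(3)] ys dim by (simp add: e'_def)
  qed
  ultimately show ?case by blast
qed

lemma eventually_tuple_transform_kron_pow:
  assumes P: "prob_tuple d n P" and Q: "prob_tuple d m Q" and suppQ: "common_supp Q {..<d} \<noteq> {}"
    and "0 < d" and less: "\<forall>(\<alpha>, C) \<in> param_set d. Phi \<alpha> C P < Phi \<alpha> C Q"
  shows "\<forall>\<^sub>F N in sequentially. tuple_transform d (n ^ N) (m ^ N)
    (\<lambda>k. kron_pow (P k) N) (\<lambda>k. kron_pow (Q k) N)"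
proof -
  have dimP: "dim_vec (P k) = n" and dimQ: "dim_vec (Q k) = m" if "k < d" for k
    using P Q that by (auto simp: prob_tuple_def prob_vec_def)
  \<comment> \<open>The product extends from the support of \<alpha> to \<open>C\<close> because the
    entries are nonzero on the summation range, where a zero exponent gives 1; at base 0 it would
    give 0.\<close>
  have Phi: "Phi (vec d \<alpha>) C P = (\<Sum>i | i \<in> {..<n} \<and> (\<forall>k\<in>C. P k $ i \<noteq> 0). \<Prod>k\<in>C. (P k $ i) powr \<alpha> k)"
    if C: "C \<subseteq> {..<d}" "C \<noteq> {}" and \<alpha>: "\<alpha> \<in> simplex_on C" and dim: "\<And>k. k < d \<Longrightarrow> dim_vec (P k) = n"
    for P \<alpha> C n
  proof -
    have "supp_vec (vec d \<alpha>) = {k \<in> C. \<alpha> k \<noteq> 0}"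
      using C \<alpha> by (auto simp: supp_vec_def simplex_on_def)
    then have "(\<Prod>k\<in>supp_vec (vec d \<alpha>). (P k $ i) powr (vec d \<alpha> $ k)) = (\<Prod>k\<in>C. (P k $ i) powr \<alpha> k)"
      if "\<forall>k\<in>C. P k $ i \<noteq> 0" for i
      using C that finite_subset[OF C(1)] by (intro prod.mono_neutral_cong_left) auto
    moreover have "Phi (vec d \<alpha>) C P = (\<Sum>i | i < n \<and> (\<forall>c\<in>C. P c $ i \<noteq> 0).
        \<Prod>k\<in>supp_vec (vec d \<alpha>). (P k $ i) powr (vec d \<alpha> $ k))"
      by (rule Phi_eq[OF C(2)]) (use C dim in auto)
    ultimately show ?thesis by simp
  qed
  have "\<forall>\<^sub>F N in sequentially. \<exists>T.
    (\<forall>x\<in>words {..<n} N. \<forall>y\<in>words {..<m} N. (0::real) \<le> T x y) \<and>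
    (\<forall>x\<in>words {..<n} N. (\<Sum>y\<in>words {..<m} N. T x y) = 1) \<and>
    (\<forall>k<d. \<forall>y\<in>words {..<m} N. (\<Sum>x\<in>words {..<n} N. T x y * prod_list (map (($) (P k)) x))
      = prod_list (map (($) (Q k)) y))"
  proof (rule eventually_words_transform)
    obtain j where j: "j \<in> common_supp Q {..<d}" using suppQ by auto
    then have "j < m" using \<open>0 < d\<close> dimQ[of 0] by (auto simp: common_supp_def supp_vec_def)
    then show "\<exists>j\<in>{..<m}. \<forall>k<d. Q k $ j \<noteq> 0"
      using j by (auto simp: common_supp_def supp_vec_def)
  next
    fix C \<alpha> assume C: "C \<subseteq> {..<d}" "2 \<le> card C" and \<alpha>: "\<alpha> \<in> simplex_on C"
    have ne: "C \<noteq> {}" using C(2) by auto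
    have "(\<Sum>k<d. \<alpha> k) = (\<Sum>k\<in>C. \<alpha> k)"
      using C \<alpha> by (intro sum.mono_neutral_right) (auto simp: simplex_on_def)
    \<comment> \<open>The excluded pairs have a singleton as second component, which
      \<open>2 \<le> card C\<close> rules out.\<close>
    then have "(vec d \<alpha>, C) \<in> param_set d"
      using C \<alpha> by (auto simp: param_set_def prob_vec_def simplex_on_def supp_vec_def)
    then have "Phi (vec d \<alpha>) C P < Phi (vec d \<alpha>) C Q" using less by auto
    then show "(\<Sum>i | i \<in> {..<n} \<and> (\<forall>k\<in>C. P k $ i \<noteq> 0). \<Prod>k\<in>C. (P k $ i) powr \<alpha> k)
      < (\<Sum>j | j \<in> {..<m} \<and> (\<forall>k\<in>C. Q k $ j \<noteq> 0). \<Prod>k\<in>C. (Q k $ j) powr \<alpha> k)"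
      using Phi[OF C(1) ne \<alpha>, of P n] Phi[OF C(1) ne \<alpha>, of Q m] dimP dimQ by simp
  qed (use P Q in \<open>auto simp: prob_tuple_def prob_vec_def\<close>)
  then show ?thesis
  proof eventually_elim
    case (elim N)
    then obtain T where T: "\<forall>x\<in>words {..<n} N. \<forall>y\<in>words {..<m} N. (0::real) \<le> T x y"
      "\<forall>x\<in>words {..<n} N. (\<Sum>y\<in>words {..<m} N. T x y) = 1"
      "\<forall>k<d. \<forall>y\<in>words {..<m} N. (\<Sum>x\<in>words {..<n} N. T x y * prod_list (map (($) (P k)) x))
        = prod_list (map (($) (Q k)) y)" by blast
    obtain e where e: "bij_betw e (words {..<n} N) {..<n ^ N}"
      "\<And>v xs. dim_vec v = n \<Longrightarrow> xs \<in> words {..<n} N \<Longrightarrow> kron_pow v N $ e xs = prod_list (map (($) v) xs)"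
      using ex_kron_pow_index[of n N] by blast
    obtain e' where e': "bij_betw e' (words {..<m} N) {..<m ^ N}"
      "\<And>v xs. dim_vec v = m \<Longrightarrow> xs \<in> words {..<m} N \<Longrightarrow> kron_pow v N $ e' xs = prod_list (map (($) v) xs)"
      using ex_kron_pow_index[of m N] by blast
    show ?case
      by (rule tuple_transformI[OF e(1) e'(1), where T = T]) (use T e(2) e'(2) dimP dimQ in auto)
  qed
qed

theorem theorem13:
  fixes d n m :: nat and P Q :: "nat \<Rightarrow> real vec"
  assumes "2 \<le> d"
    and "prob_tuple d n P" and "prob_tuple d m Q"
    and "common_supp P {..<d} \<noteq> {}" and "common_supp Q {..<d} \<noteq> {}"
  shows
    "((\<forall>(\<alpha>, C) \<in> param_set d. Phi \<alpha> C P < Phi \<alpha> C Q) \<longrightarrow>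
       (\<exists>l R. is_catalyst d n m P Q l R) \<and>
       (\<exists>N0. \<forall>N\<ge>N0. \<exists>l. is_catalyst d n m P Q l (\<lambda>k. standard_catalyst (P k) (Q k) N)) \<and>
       (\<exists>N0. \<forall>N\<ge>N0. tuple_transform d (n ^ N) (m ^ N)
          (\<lambda>k. kron_pow (P k) N) (\<lambda>k. kron_pow (Q k) N)))
     \<and>
     ((\<exists>l R. is_catalyst d n m P Q l R) \<or>
      (\<exists>N0. \<forall>N\<ge>N0. tuple_transform d (n ^ N) (m ^ N)
          (\<lambda>k. kron_pow (P k) N) (\<lambda>k. kron_pow (Q k) N)) \<longrightarrow>
       (\<forall>(\<alpha>, C) \<in> param_set d. Phi \<alpha> C P \<le> Phi \<alpha> C Q))"
proof -
  let ?catalytic = "\<exists>l R. is_catalyst d n m P Q l R"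
    and ?standard = "\<exists>N0. \<forall>N\<ge>N0. \<exists>l. is_catalyst d n m P Q l (\<lambda>k. standard_catalyst (P k) (Q k) N)"
    and ?asymptotic = "\<exists>N0. \<forall>N\<ge>N0. tuple_transform d (n ^ N) (m ^ N)
          (\<lambda>k. kron_pow (P k) N) (\<lambda>k. kron_pow (Q k) N)"
  have asymptotic: ?asymptotic if "\<forall>(\<alpha>, C) \<in> param_set d. Phi \<alpha> C P < Phi \<alpha> C Q"
    using eventually_tuple_transform_kron_pow[OF assms(2,3,5) _ that] assms(1)
    by (simp add: eventually_sequentially)
  \<comment> \<open>The catalyst with parameter N uses the transformation of the powers of order
    \<open>N + 1\<close>, so the threshold for the powers also serves for the catalysts.\<close>
  have standard: ?standard if "?asymptotic"
    using that is_catalyst_standard_catalyst[OF assms(2-4)] le_SucI by meson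
  have catalytic: ?catalytic if "?standard"
    using that by blast
  have "\<forall>(\<alpha>, C) \<in> param_set d. Phi \<alpha> C P \<le> Phi \<alpha> C Q" if "?catalytic"
    using that Phi_mono_catalyst[OF _ assms(2,3)] by (auto simp: param_set_def)
  then show ?thesis using asymptotic standard catalytic by blast
qed

end
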